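(* Let $(X,\mathcal F)$ be a transitive compact Polish foliated space. Then residually many leaves have the same asymptotic dimension; that is, there are a residual saturated subset $Y\subset X$ and some $n\in\mathbb N\cup\{\infty\}$ such that every leaf contained in $Y$ has asymptotic dimension $n$.
   Context: Foliated spaces. A (topological) foliated structure $\mathcal F$ of dimension $n$ on a space $X$ is given by an atlas $\{(U_i,\phi_i)\}$, where $\{U_i\}$ is an open cover of $X$ and $\phi_i:U_i\to B_i\times Z_i$ are homeomorphisms, with $B_i\subset\mathbb R^n$ an open ball and $Z_i$ a locally compact Polish space, whose changes of coordinates are locally of the form $\phi_j\phi_i^{-1}(x,z)=(x_{ij}(x,z),h_{ij}(z))$. The sets $\phi_i^{-1}(B_i\times\{z\})$ are the plaques; the leaves are the connected components of $X$ with the (leaf) topology whose basic open sets are the plaques of all foliated charts. $(X,\mathcal F)$ is a compact Polish foliated space if $X$ is compact, Hausdorff and second countable. It is transitive if some leaf is dense in $X$. A subset of $X$ is saturated if it is a union of leaves, and residual if it contains a countable intersection of dense open subsets. Leaf metrics. A foliated atlas $\mathcal U=\{(U_i,\phi_i)\}$ is regular if: each $(U_i,\phi_i)$ is the restriction of a foliated chart $(\widetilde U_i,\tilde\phi_i)$ with $\overline{U_i}\subset\widetilde U_i$; $\{U_i\}$ is locally finite; and the closure of every plaque of $(U_i,\phi_i)$ meets at most the closure of one plaque of $(U_j,\phi_j)$, for all $i,j$. Fix a regular foliated atlas $\mathcal U$. For $x,y$ in the same leaf, $d^*_{\mathcal U}(x,y)=0$ if $x=y$, and otherwise it is the minimum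 number of $\mathcal U$-plaques whose union is connected and contains $x$ and $y$. Leaves are considered as metric spaces with $d^*_{\mathcal U}$; their asymptotic dimension does not depend on the choice of $\mathcal U$. Asymptotic dimension. A family $\mathcal V$ of subsets of a metric space $M$ is uniformly bounded if there is $D>0$ with $\operatorname{diam}V\le D$ for all $V\in\mathcal V$. The multiplicity of a cover is the least $n\in\mathbb N\cup\{\infty\}$ such that at most $n$ of its elements meet at any point. A cover $\mathcal V$ refines a cover $\mathcal W$ if each element of $\mathcal V$ is contained in some element of $\mathcal W$. The asymptotic dimension of $M$ is the least $n\in\mathbb N\cup\{\infty\}$ such that any uniformly bounded open cover of $M$ refines some uniformly bounded open cover with multiplicity $\le n+1$. *)

theory Defs
  imports "HOL-Analysis.Analysis" "HOL-Library.Extended_Nat"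
begin

section \<open>Foliated spaces\<close>

text \<open>
  The dimension is a natural number \<open>n\<close> (0 allowed), and the role of \<open>n\<close>-dimensional real
  space is played by \<^const>\<open>Euclidean_space\<close>, whose points are the sequences vanishing from
  index \<open>n\<close> on.
\<close>

definition open_Euclidean_ball :: "nat \<Rightarrow> (nat \<Rightarrow> real) set \<Rightarrow> bool" where
  "open_Euclidean_ball n B \<longleftrightarrow>
     (\<exists>c r. c \<in> topspace (Euclidean_space n) \<and> r > 0 \<and>
            B = {x \<in> topspace (Euclidean_space n). L2_set (\<lambda>i. x i - c i) {..<n} < r})"

definition Polish_space :: "'a topology \<Rightarrow> bool" where
  "Polish_space Z \<longleftrightarrow> completely_metrizable_space Z \<and> second_countable Z"

text \<open>
  A chart \<open>\<phi> : U \<rightarrow> B \<times> Z\<close>; the values of \<open>\<phi>\<close> outside \<open>U\<close> are irrelevant.  The transversals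
  \<open>Z\<close> of all charts are topologies on subsets of one arbitrary type \<open>'z\<close>.
  No generality is lost: a transversal embeds in its chart domain as \<open>{b} \<times> Z\<close>, so already
  \<open>'z = 'a\<close> accommodates every chart of a space on \<open>'a\<close>.
\<close>

record ('a, 'z) fol_chart =
  chart_dom :: "'a set"
  chart_map :: "'a \<Rightarrow> (nat \<Rightarrow> real) \<times> 'z"
  chart_ball :: "(nat \<Rightarrow> real) set"
  chart_trans :: "'z topology"

definition is_fol_chart :: "'a topology \<Rightarrow> nat \<Rightarrow> ('a, 'z) fol_chart \<Rightarrow> bool" where
  "is_fol_chart X n c \<longleftrightarrow>
     openin X (chart_dom c) \<and>
     open_Euclidean_ball n (chart_ball c) \<and>
     locally_compact_space (chart_trans c) \<and> Polish_space (chart_trans c) \<and>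
     homeomorphic_map (subtopology X (chart_dom c))
       (prod_topology (subtopology (Euclidean_space n) (chart_ball c)) (chart_trans c))
       (chart_map c)"

text \<open>
  The change of coordinates from \<open>c\<close> to \<open>c'\<close> has, near each point of its domain, the form
  \<open>(x, z) \<mapsto> (f (x, z), h z)\<close>.
\<close>

definition fol_change :: "'a topology \<Rightarrow> nat \<Rightarrow> ('a, 'z) fol_chart \<Rightarrow> ('a, 'z) fol_chart \<Rightarrow> bool" where
  "fol_change X n c c' \<longleftrightarrow>
     (\<forall>p \<in> chart_map c ` (chart_dom c \<inter> chart_dom c').
        \<exists>W. openin (prod_topology (subtopology (Euclidean_space n) (chart_ball c)) (chart_trans c)) W \<and>
            p \<in> W \<and> W \<subseteq> chart_map c ` (chart_dom c \<inter> chart_dom c') \<and>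
            (\<exists>f h. \<forall>x z. (x, z) \<in> W \<longrightarrow>
               chart_map c' (inv_into (chart_dom c) (chart_map c) (x, z)) = (f (x, z), h z)))"

definition fol_atlas :: "'a topology \<Rightarrow> nat \<Rightarrow> ('a, 'z) fol_chart set \<Rightarrow> bool" where
  "fol_atlas X n \<A> \<longleftrightarrow>
     (\<forall>c \<in> \<A>. is_fol_chart X n c) \<and>
     (\<Union>c \<in> \<A>. chart_dom c) = topspace X \<and>
     (\<forall>c \<in> \<A>. \<forall>c' \<in> \<A>. fol_change X n c c')"

text \<open>
  A foliated structure is given by a foliated atlas \<open>\<F>\<close>, and its foliated charts are all the
  charts compatible with \<open>\<F>\<close>.
\<close>

definition fol_charts :: "'a topology \<Rightarrow> nat \<Rightarrow> ('a, 'z) fol_chart set \<Rightarrow> ('a, 'z) fol_chart set" where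
  "fol_charts X n \<F> =
     {c. is_fol_chart X n c \<and> (\<forall>c' \<in> \<F>. fol_change X n c c' \<and> fol_change X n c' c)}"

definition plaques :: "('a, 'z) fol_chart \<Rightarrow> 'a set set" where
  "plaques c =
     {{x \<in> chart_dom c. chart_map c x \<in> chart_ball c \<times> {z}} | z. z \<in> topspace (chart_trans c)}"

definition leaf_topology :: "'a topology \<Rightarrow> nat \<Rightarrow> ('a, 'z) fol_chart set \<Rightarrow> 'a topology" where
  "leaf_topology X n \<F> = topology_generated_by (\<Union>c \<in> fol_charts X n \<F>. plaques c)"

definition leaves :: "'a topology \<Rightarrow> nat \<Rightarrow> ('a, 'z) fol_chart set \<Rightarrow> 'a set set" where
  "leaves X n \<F> = connected_components_of (leaf_topology X n \<F>)"

definition compact_Polish_foliated_space :: "'a topology \<Rightarrow> nat \<Rightarrow> ('a, 'z) fol_chart set \<Rightarrow> bool" where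
  "compact_Polish_foliated_space X n \<F> \<longleftrightarrow>
     compact_space X \<and> Hausdorff_space X \<and> second_countable X \<and> fol_atlas X n \<F>"

definition transitive_foliation :: "'a topology \<Rightarrow> nat \<Rightarrow> ('a, 'z) fol_chart set \<Rightarrow> bool" where
  "transitive_foliation X n \<F> \<longleftrightarrow> (\<exists>L \<in> leaves X n \<F>. X closure_of L = topspace X)"

definition saturated_set :: "'a topology \<Rightarrow> nat \<Rightarrow> ('a, 'z) fol_chart set \<Rightarrow> 'a set \<Rightarrow> bool" where
  "saturated_set X n \<F> Y \<longleftrightarrow> (\<exists>\<L> \<subseteq> leaves X n \<F>. Y = \<Union>\<L>)"

text \<open>The intersection with \<^term>\<open>topspace X\<close> matters only for the empty family.\<close>

definition residual_set :: "'a topology \<Rightarrow> 'a set \<Rightarrow> bool" where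
  "residual_set X Y \<longleftrightarrow>
     Y \<subseteq> topspace X \<and>
     (\<exists>\<G>. countable \<G> \<and> (\<forall>G \<in> \<G>. openin X G \<and> X closure_of G = topspace X) \<and>
          topspace X \<inter> \<Inter>\<G> \<subseteq> Y)"

section \<open>Regular atlases and the leaf metric\<close>

definition regular_fol_atlas ::
  "'a topology \<Rightarrow> nat \<Rightarrow> ('a, 'z) fol_chart set \<Rightarrow> ('a, 'z) fol_chart set \<Rightarrow> bool" where
  "regular_fol_atlas X n \<F> \<U> \<longleftrightarrow>
     fol_atlas X n \<U> \<and> \<U> \<subseteq> fol_charts X n \<F> \<and>
     (\<forall>c \<in> \<U>. \<exists>c' \<in> fol_charts X n \<F>.
        X closure_of chart_dom c \<subseteq> chart_dom c' \<and>
        (\<forall>x \<in> chart_dom c. chart_map c x = chart_map c' x)) \<and>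
     (\<forall>x \<in> topspace X. \<exists>N. openin X N \<and> x \<in> N \<and> finite {c \<in> \<U>. chart_dom c \<inter> N \<noteq> {}}) \<and>
     (\<forall>c \<in> \<U>. \<forall>c' \<in> \<U>. \<forall>P \<in> plaques c. \<forall>Q \<in> plaques c'. \<forall>Q' \<in> plaques c'.
        X closure_of P \<inter> X closure_of Q \<noteq> {} \<and> X closure_of P \<inter> X closure_of Q' \<noteq> {} \<longrightarrow> Q = Q')"

text \<open>
  The leaf metric \<open>d\<^sup>*\<close> of \<open>\<U>\<close>.  It is meaningful for two points of one leaf only; connectedness
  of a union of plaques refers to the leaf topology.
\<close>

definition plaque_dist ::
  "'a topology \<Rightarrow> nat \<Rightarrow> ('a, 'z) fol_chart set \<Rightarrow> ('a, 'z) fol_chart set \<Rightarrow> 'a \<Rightarrow> 'a \<Rightarrow> real" where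
  "plaque_dist X n \<F> \<U> x y =
     (if x = y then 0
      else real (LEAST k. \<exists>\<P> \<subseteq> (\<Union>c \<in> \<U>. plaques c). finite \<P> \<and> card \<P> = k \<and>
                   connectedin (leaf_topology X n \<F>) (\<Union>\<P>) \<and> x \<in> \<Union>\<P> \<and> y \<in> \<Union>\<P>))"

section \<open>Asymptotic dimension\<close>

text \<open>As in \<^locale>\<open>Metric_space\<close>, a metric space is a carrier \<open>M\<close> with a distance \<open>d\<close>.\<close>

definition uniformly_bounded_family :: "('a \<Rightarrow> 'a \<Rightarrow> real) \<Rightarrow> 'a set set \<Rightarrow> bool" where
  "uniformly_bounded_family d \<V> \<longleftrightarrow> (\<exists>D>0. \<forall>V \<in> \<V>. \<forall>x \<in> V. \<forall>y \<in> V. d x y \<le> D)"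

definition open_cover :: "'a set \<Rightarrow> ('a \<Rightarrow> 'a \<Rightarrow> real) \<Rightarrow> 'a set set \<Rightarrow> bool" where
  "open_cover M d \<V> \<longleftrightarrow> (\<forall>V \<in> \<V>. openin (Metric_space.mtopology M d) V) \<and> \<Union>\<V> = M"

definition has_at_most :: "'b set \<Rightarrow> enat \<Rightarrow> bool" where
  "has_at_most S n \<longleftrightarrow> n = \<infinity> \<or> (finite S \<and> enat (card S) \<le> n)"

definition cover_multiplicity :: "'a set \<Rightarrow> 'a set set \<Rightarrow> enat" where
  "cover_multiplicity M \<V> = (LEAST n. \<forall>x \<in> M. has_at_most {V \<in> \<V>. x \<in> V} n)"

definition refines :: "'a set set \<Rightarrow> 'a set set \<Rightarrow> bool" where
  "refines \<V> \<W> \<longleftrightarrow> (\<forall>V \<in> \<V>. \<exists>W \<in> \<W>. V \<subseteq> W)"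

definition asdim :: "'a set \<Rightarrow> ('a \<Rightarrow> 'a \<Rightarrow> real) \<Rightarrow> enat" where
  "asdim M d =
     (LEAST n. \<forall>\<V>. open_cover M d \<V> \<and> uniformly_bounded_family d \<V> \<longrightarrow>
        (\<exists>\<W>. open_cover M d \<W> \<and> uniformly_bounded_family d \<W> \<and> refines \<V> \<W> \<and>
             cover_multiplicity M \<W> \<le> n + 1))"

end

theory Submission
  imports Defs
begin

text \<open>
  Two leaves through generic points are locally indistinguishable: every finite ball in the
  adjacency graph of the plaques of one leaf occurs as a ball in the graph of any dense leaf.
  Indeed the combinatorial type of the ball of radius \<open>m\<close> around a point \<open>x\<close> is determined
  by membership of \<open>x\<close> in finitely many open sets, which record along which chains of charts
  \<open>x\<close> can be continued and which pairs of chains separate.  If \<open>x\<close> avoids the frontiers of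
  these countably many open sets, the type is locally constant at \<open>x\<close>, so every dense leaf
  realizes it.  The existence of covers of given Lebesgue number, bound and multiplicity is, by
  compactness, a condition on finite balls; hence generic leaves have the same asymptotic
  dimension.
\<close>

text \<open>Regularity makes chains deterministic: a starting point and a word of charts admit at
  most one end plaque over any given chart, so words serve as coordinates on the ball about
  \<open>x\<close>. The obstacle is that these data are only semicontinuous: a word that fails at
  \<open>x\<close> may succeed arbitrarily close by, and two words that end in one plaque from
  \<open>x\<close> may end in different ones nearby. Off the frontiers, failure and coincidence are
  stable as well. Genericity enters on one side only: the second point is any point of a dense leaf
  close to \<open>x\<close>, so covers pass from every dense leaf to a generic one with the same
  constants, and equality follows because generic leaves are dense too. Their density is a countable
  condition, since the leaves meeting a given nonempty open set fill an open set that contains the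
  leaf provided by transitivity. The comparison of \<open>asdim\<close> with graphs keeps the
  multiplicity exactly; only the bounds change, since a walk of length \<open>k\<close> spans
  distance at most \<open>k + 1\<close>, while distance \<open>k\<close> is spanned by a walk of
  length \<open>k * k + 2\<close>.\<close>

section \<open>Covers of locally finite graphs\<close>

text \<open>
  \<open>\<sigma> v\<close> is the set of (centres of) members of the cover that contain \<open>v\<close>; each member lies in
  the \<open>D\<close>-ball about its centre, and every \<open>r\<close>-ball lies in some member.
\<close>

definition graph_cover :: "('v \<times> 'v) set \<Rightarrow> 'v set \<Rightarrow> nat \<Rightarrow> nat \<Rightarrow> nat \<Rightarrow> ('v \<Rightarrow> 'v set) \<Rightarrow> bool" where
  "graph_cover E V N r D \<sigma> \<longleftrightarrow>
     (\<forall>v\<in>V. \<sigma> v \<subseteq> (E ^^ D) `` {v} \<and> card (\<sigma> v) \<le> N \<and> (\<exists>a. \<forall>u\<in>(E ^^ r) `` {v}. a \<in> \<sigma> u))"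

lemma relpow_closed: "E `` V \<subseteq> V \<Longrightarrow> v \<in> V \<Longrightarrow> (v, u) \<in> E ^^ k \<Longrightarrow> u \<in> V"
  by (induction k arbitrary: u) auto

lemma finite_relpow_Image:
  assumes "E `` V \<subseteq> V" "\<And>v. v \<in> V \<Longrightarrow> finite (E `` {v})" "v \<in> V"
  shows "finite ((E ^^ k) `` {v})"
proof (induction k)
  case (Suc k)
  have "(E ^^ Suc k) `` {v} = (\<Union>u\<in>(E ^^ k) `` {v}. E `` {u})"
    by auto
  then show ?case
    using Suc assms relpow_closed[OF assms(1,3)] by auto
qed auto

lemma relpow_refl_mono:
  assumes "E `` V \<subseteq> V" "\<And>v. v \<in> V \<Longrightarrow> (v, v) \<in> E" "v \<in> V" "(v, u) \<in> E ^^ k" "k \<le> m"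
  shows "(v, u) \<in> E ^^ m"
  using assms(5)
proof (induction m rule: dec_induct)
  case base
  then show ?case using assms by simp
next
  case (step m)
  then show ?case
    using relpow_closed[OF assms(1,3) step.IH] assms(2) by auto
qed

lemma relpow_subset:
  fixes R S :: "('b \<times> 'b) set"
  shows "R \<subseteq> S \<Longrightarrow> R ^^ k \<subseteq> S ^^ k"
  by (induction k) (simp_all add: relcomp_mono)

text \<open>Local finiteness leaves finitely many candidates for each label set, so their product is
  compact by Tychonoff's theorem and the finite intersection property yields a common point. A local
  cover may be empty away from the \<open>r\<close>-balls about \<open>F\<close>, since the bounds
  on size and position hold for empty sets.\<close>

lemma graph_cover_compactness:
  assumes closed: "E `` V \<subseteq> V" and refl: "\<And>v. v \<in> V \<Longrightarrow> (v, v) \<in> E"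
    and fin: "\<And>v. v \<in> V \<Longrightarrow> finite (E `` {v})"
    and local_cover: "\<And>F. finite F \<Longrightarrow> F \<subseteq> V \<Longrightarrow>
      \<exists>\<sigma>. (\<forall>v\<in>V. \<sigma> v \<subseteq> (E ^^ D) `` {v} \<and> card (\<sigma> v) \<le> N) \<and>
          (\<forall>v\<in>F. \<exists>a. \<forall>u\<in>(E ^^ r) `` {v}. a \<in> \<sigma> u)"
  shows "\<exists>\<sigma>. graph_cover E V N r D \<sigma>"
proof -
  define C where "C v = {A. A \<subseteq> (E ^^ D) `` {v} \<and> card A \<le> N}" for v
  define T where "T = product_topology (\<lambda>v. discrete_topology (C v)) V"
  define K where "K v = {\<sigma> \<in> topspace T. \<exists>a. \<forall>u\<in>(E ^^ r) `` {v}. a \<in> \<sigma> u}" for v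
  have finC: "finite (C v)" if "v \<in> V" for v
    unfolding C_def using finite_relpow_Image[OF closed fin that]
    by (auto intro: finite_subset[of _ "Pow ((E ^^ D) `` {v})"])
  have compT: "compact_space T"
    unfolding T_def compact_space_product_topology using finC
    by (auto simp: compact_space_discrete_topology)
  have closedK: "closedin T (K v)" if v: "v \<in> V" for v
  proof -
    let ?G = "\<lambda>a u. {\<sigma> \<in> topspace T. \<sigma> u \<in> {A \<in> C u. a \<in> A}}"
    have G: "closedin T (?G a u)" if "u \<in> V" for a u
      by (rule closedin_continuous_map_preimage[where Y = "discrete_topology (C u)"])
        (use that in \<open>auto simp: T_def intro!: continuous_map_product_projection[where X = "\<lambda>v. discrete_topology (C v)"]\<close>)
    have vr: "(v, v) \<in> E ^^ r"
      using relpow_refl_mono[OF closed refl v, of v 0 r] by auto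
    \<comment> \<open>Membership in \<open>K v\<close> looks at finitely many coordinates only: the
      common label \<open>a\<close> lies in \<open>\<sigma> v\<close>, since \<open>v\<close> is in
      its own \<open>r\<close>-ball, and hence in the finite \<open>D\<close>-ball of
      \<open>v\<close>.\<close>
    have "K v = (\<Union>a\<in>(E ^^ D) `` {v}. \<Inter>u\<in>(E ^^ r) `` {v}. ?G a u)"
    proof (intro equalityI subsetI)
      fix \<sigma> assume "\<sigma> \<in> K v"
      then obtain a where a: "\<sigma> \<in> topspace T" "\<forall>u\<in>(E ^^ r) `` {v}. a \<in> \<sigma> u"
        by (auto simp: K_def)
      have s: "\<sigma> u \<in> C u" if "u \<in> V" for u
        using a(1) that by (auto simp: T_def)
      have "a \<in> (E ^^ D) `` {v}"
        using s[OF v] a(2) vr by (auto simp: C_def)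
      then show "\<sigma> \<in> (\<Union>a\<in>(E ^^ D) `` {v}. \<Inter>u\<in>(E ^^ r) `` {v}. ?G a u)"
        using a s relpow_closed[OF closed v] by blast
    next
      fix \<sigma> assume "\<sigma> \<in> (\<Union>a\<in>(E ^^ D) `` {v}. \<Inter>u\<in>(E ^^ r) `` {v}. ?G a u)"
      then show "\<sigma> \<in> K v"
        using vr unfolding K_def by blast
    qed
    moreover have "closedin T (\<Inter>u\<in>(E ^^ r) `` {v}. ?G a u)" for a
      using vr relpow_closed[OF closed v] by (intro closedin_INT G) auto
    then have "closedin T (\<Union>a\<in>(E ^^ D) `` {v}. \<Inter>u\<in>(E ^^ r) `` {v}. ?G a u)"
      by (intro closedin_Union finite_imageI finite_relpow_Image[OF closed fin v]) blast+
    ultimately show ?thesis by simp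
  qed
  \<comment> \<open>Adding \<open>topspace T\<close> to the family puts the common point into
    \<open>T\<close> even when \<open>V\<close> is empty.\<close>
  have "\<Inter> (insert (topspace T) (K ` V)) \<noteq> {}"
  proof (rule compT[unfolded compact_space_fip, rule_format], intro conjI ballI allI impI)
    fix Z assume "Z \<in> insert (topspace T) (K ` V)"
    then show "closedin T Z" using closedK by auto
  next
    fix \<G> assume "finite \<G> \<and> \<G> \<subseteq> insert (topspace T) (K ` V)"
    then have "finite (\<G> - {topspace T})" "\<G> - {topspace T} \<subseteq> K ` V" by auto
    then obtain F where F: "F \<subseteq> V" "finite F" "\<G> - {topspace T} = K ` F"
      using finite_subset_image by metis
    obtain \<sigma> where \<sigma>: "\<forall>v\<in>V. \<sigma> v \<subseteq> (E ^^ D) `` {v} \<and> card (\<sigma> v) \<le> N"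
        "\<forall>v\<in>F. \<exists>a. \<forall>u\<in>(E ^^ r) `` {v}. a \<in> \<sigma> u"
      using local_cover[OF F(2,1)] by blast
    have T: "restrict \<sigma> V \<in> topspace T"
      using \<sigma>(1) by (auto simp: T_def C_def)
    have "restrict \<sigma> V \<in> K v" if "v \<in> F" for v
    proof -
      obtain a where a: "\<forall>u\<in>(E ^^ r) `` {v}. a \<in> \<sigma> u" using \<sigma>(2) \<open>v \<in> F\<close> by blast
      have "a \<in> restrict \<sigma> V u" if "u \<in> (E ^^ r) `` {v}" for u
      proof -
        have "u \<in> V"
          using relpow_closed[OF closed] that \<open>v \<in> F\<close> F(1) by (metis Image_singleton_iff subsetD)
        then show ?thesis using a that by simp
      qed
      then show ?thesis using T unfolding K_def by blast
    qed
    then have "restrict \<sigma> V \<in> \<Inter>\<G>" using T F(3) by blast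
    then show "\<Inter>\<G> \<noteq> {}" by blast
  qed
  then obtain \<sigma> where "\<sigma> \<in> topspace T" "\<forall>v\<in>V. \<sigma> \<in> K v" by auto
  moreover from this have "\<forall>v\<in>V. \<sigma> v \<in> C v" by (auto simp: T_def)
  ultimately have "graph_cover E V N r D \<sigma>"
    by (auto simp: graph_cover_def C_def K_def)
  then show ?thesis by blast
qed

text \<open>A bisimulation of bounded depth: vertices related by \<open>\<Psi> k\<close> can be
  followed for \<open>M - k\<close> further edges. Bijectivity is demanded of the top relation and
  passes to the lower ones by monotonicity. Relations instead of maps make the notion invariant
  under converse and allow several centres at once.\<close>

definition ball_iso :: "('v \<times> 'v) set \<Rightarrow> nat \<Rightarrow> (nat \<Rightarrow> ('v \<times> 'v) set) \<Rightarrow> bool" where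
  "ball_iso E M \<Psi> \<longleftrightarrow>
     mono \<Psi> \<and> single_valued (\<Psi> M) \<and> single_valued ((\<Psi> M)\<inverse>) \<and>
     (\<forall>k<M. \<forall>v v'. (v, v') \<in> \<Psi> k \<longrightarrow>
        (\<forall>u. (v, u) \<in> E \<longrightarrow> (\<exists>u'. (v', u') \<in> E \<and> (u, u') \<in> \<Psi> (Suc k))) \<and>
        (\<forall>u'. (v', u') \<in> E \<longrightarrow> (\<exists>u. (v, u) \<in> E \<and> (u, u') \<in> \<Psi> (Suc k))))"

lemma ball_iso_forth:
  assumes "ball_iso E M \<Psi>" "(v, v') \<in> \<Psi> k" "k + m \<le> M" "(v, u) \<in> E ^^ m"
  shows "\<exists>u'. (v', u') \<in> E ^^ m \<and> (u, u') \<in> \<Psi> (k + m)"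
  using assms(3,4)
proof (induction m arbitrary: u)
  case 0
  then show ?case using assms(2) by auto
next
  case (Suc m)
  obtain w where w: "(v, w) \<in> E ^^ m" "(w, u) \<in> E" using Suc.prems(2) by auto
  obtain w' where w': "(v', w') \<in> E ^^ m" "(w, w') \<in> \<Psi> (k + m)"
    using Suc.IH[OF _ w(1)] Suc.prems(1) by auto
  have "k + m < M" using Suc.prems by simp
  then obtain u' where "(w', u') \<in> E" "(u, u') \<in> \<Psi> (Suc (k + m))"
    using assms(1) w'(2) w(2) unfolding ball_iso_def by blast
  then show ?case using w'(1) by auto
qed

lemma ball_iso_converse:
  assumes "ball_iso E M \<Psi>"
  shows "ball_iso E M (\<lambda>k. (\<Psi> k)\<inverse>)"
proof -
  have "mono (\<lambda>k. (\<Psi> k)\<inverse>)"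
    using assms by (simp add: ball_iso_def mono_def)
  then show ?thesis
    using assms unfolding ball_iso_def converse_iff converse_converse by blast
qed

lemma ball_iso_back:
  assumes "ball_iso E M \<Psi>" "(v, v') \<in> \<Psi> k" "k + m \<le> M" "(v', u') \<in> E ^^ m"
  shows "\<exists>u. (v, u) \<in> E ^^ m \<and> (u, u') \<in> \<Psi> (k + m)"
  using ball_iso_forth[OF ball_iso_converse[OF assms(1)], of v' v k m u'] assms(2-) by auto

text \<open>The labels on \<open>V'\<close> are pulled back along a ball isomorphism of depth
  \<open>r + D\<close>: from a vertex of \<open>F\<close> one goes \<open>r\<close> steps to some
  \<open>u\<close> and then \<open>D\<close> steps to a label of \<open>u\<close>. Compactness
  combines the partial covers so obtained.\<close>

lemma graph_cover_transfer:
  assumes closed: "E `` V \<subseteq> V" "E `` V' \<subseteq> V'" and refl: "\<And>v. v \<in> V \<union> V' \<Longrightarrow> (v, v) \<in> E"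
    and fin: "\<And>v. v \<in> V \<union> V' \<Longrightarrow> finite (E `` {v})" and sym: "sym E"
    and iso: "\<And>F M. finite F \<Longrightarrow> F \<subseteq> V \<Longrightarrow>
      \<exists>\<Psi>. ball_iso E M \<Psi> \<and> \<Psi> M \<subseteq> V \<times> V' \<and> (\<forall>v\<in>F. \<exists>v'. (v, v') \<in> \<Psi> 0)"
    and cover: "graph_cover E V' N r D \<sigma>'"
  shows "\<exists>\<sigma>. graph_cover E V N r D \<sigma>"
proof (rule graph_cover_compactness[OF closed(1)])
  fix F assume F: "finite F" "F \<subseteq> V"
  obtain \<Psi> where \<Psi>: "ball_iso E (r + D) \<Psi>" "\<Psi> (r + D) \<subseteq> V \<times> V'" "\<forall>v\<in>F. \<exists>v'. (v, v') \<in> \<Psi> 0"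
    using iso[OF F, of "r + D"] by blast
  let ?P = "\<Psi> (r + D)"
  have sv: "single_valued ?P" "single_valued (?P\<inverse>)" 
    using \<Psi>(1) by (simp_all add: ball_iso_def)
  have mono: "(v, v') \<in> ?P" if "(v, v') \<in> \<Psi> k" "k \<le> r + D" for v v' k
    using \<Psi>(1) that monoD[of \<Psi> k "r + D"] unfolding ball_iso_def by blast
  define \<sigma> where "\<sigma> v = {a \<in> (E ^^ D) `` {v}. \<exists>v' a'. (v, v') \<in> ?P \<and> (a, a') \<in> ?P \<and> a' \<in> \<sigma>' v'}" for v
  have fin': "finite (\<sigma>' v')" if "v' \<in> V'" for v'
  proof (rule finite_subset)
    show "\<sigma>' v' \<subseteq> (E ^^ D) `` {v'}" using cover that by (auto simp: graph_cover_def)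
    show "finite ((E ^^ D) `` {v'})" using finite_relpow_Image[OF closed(2) _ that] fin by blast
  qed
  have "card (\<sigma> v) \<le> N" for v
  proof (cases "\<exists>v'. (v, v') \<in> ?P")
    case False
    then have "\<sigma> v = {}" by (auto simp: \<sigma>_def)
    then show ?thesis by simp
  next
    case True
    then obtain v' where v': "(v, v') \<in> ?P" by blast
    then have "v' \<in> V'" using \<Psi>(2) by blast
    have "\<sigma> v \<subseteq> {a. \<exists>a'\<in>\<sigma>' v'. (a, a') \<in> ?P}"
      using v' sv(1) by (auto simp: \<sigma>_def single_valued_def)
    also have "\<dots> \<subseteq> (\<lambda>a'. THE a. (a, a') \<in> ?P) ` \<sigma>' v'"
    proof
      fix a assume "a \<in> {a. \<exists>a'\<in>\<sigma>' v'. (a, a') \<in> ?P}"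
      then obtain a' where a': "a' \<in> \<sigma>' v'" "(a, a') \<in> ?P" by blast
      then have "(THE a. (a, a') \<in> ?P) = a"
        using sv(2) by (intro the_equality) (auto simp: single_valued_def)
      then show "a \<in> (\<lambda>a'. THE a. (a, a') \<in> ?P) ` \<sigma>' v'"
        using a'(1) by blast
    qed
    finally have "card (\<sigma> v) \<le> card (\<sigma>' v')"
      using surj_card_le fin'[OF \<open>v' \<in> V'\<close>] by blast
    then show ?thesis using cover \<open>v' \<in> V'\<close> unfolding graph_cover_def by fastforce
  qed
  moreover have "\<exists>a. \<forall>u\<in>(E ^^ r) `` {v}. a \<in> \<sigma> u" if "v \<in> F" for v
  proof -
    obtain v' where v': "(v, v') \<in> \<Psi> 0" using \<Psi>(3) \<open>v \<in> F\<close> by blast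
    then have "v' \<in> V'" using \<Psi>(2) mono[OF v'] by blast
    then obtain a' where a': "\<And>u'. (v', u') \<in> E ^^ r \<Longrightarrow> a' \<in> \<sigma>' u'"
      using cover unfolding graph_cover_def by fast
    have "(v', v') \<in> E ^^ r"
      using relpow_refl_mono[OF closed(2) _ \<open>v' \<in> V'\<close>, of v' 0 r] refl by auto
    then have "(v', a') \<in> E ^^ D"
      using a' cover \<open>v' \<in> V'\<close> by (auto simp: graph_cover_def)
    then obtain a where a: "(v, a) \<in> E ^^ D" "(a, a') \<in> \<Psi> D"
      using ball_iso_back[OF \<Psi>(1) v', of D] by auto
    have "a \<in> \<sigma> u" if u: "(v, u) \<in> E ^^ r" for u
    proof -
      obtain u' where u': "(v', u') \<in> E ^^ r" "(u, u') \<in> \<Psi> r"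
        using ball_iso_forth[OF \<Psi>(1) v' _ u] by auto
      have "(u', a') \<in> E ^^ D"
        using a'[OF u'(1)] cover relpow_closed[OF closed(2) \<open>v' \<in> V'\<close> u'(1)]
        by (auto simp: graph_cover_def)
      then obtain b where b: "(u, b) \<in> E ^^ D" "(b, a') \<in> ?P"
        using ball_iso_back[OF \<Psi>(1) u'(2), of D] by auto
      \<comment> \<open>Both \<open>a\<close> and \<open>b\<close> correspond to \<open>a'\<close>,
        so injectivity of the top relation identifies the lift made at \<open>v\<close> with the one
        made at \<open>u\<close>. One label thus serves the whole \<open>r\<close>-ball.\<close>
      have "b = a"
        using b(2) mono[OF a(2)] sv(2) by (auto simp: single_valued_def)
      moreover have "(u, u') \<in> ?P"
        using mono[OF u'(2)] by simp
      ultimately show ?thesis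
        using b a'[OF u'(1)] unfolding \<sigma>_def by blast
    qed
    then show ?thesis by blast
  qed
  ultimately show "\<exists>\<sigma>. (\<forall>v\<in>V. \<sigma> v \<subseteq> (E ^^ D) `` {v} \<and> card (\<sigma> v) \<le> N) \<and>
          (\<forall>v\<in>F. \<exists>a. \<forall>u\<in>(E ^^ r) `` {v}. a \<in> \<sigma> u)"
    by (intro exI[of _ \<sigma>]) (auto simp: \<sigma>_def)
qed (use refl fin in auto)

section \<open>Foliated charts\<close>

text \<open>The ball is star-shaped: it is the union of the segments from its centre to its points,
  all of which contain the centre.\<close>

lemma connectedin_open_Euclidean_ball:
  assumes "open_Euclidean_ball n B"
  shows "connectedin (Euclidean_space n) B" "B \<noteq> {}"
proof -
  obtain c r where c: "c \<in> topspace (Euclidean_space n)" and "r > 0"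
    and B: "B = {x \<in> topspace (Euclidean_space n). L2_set (\<lambda>i. x i - c i) {..<n} < r}"
    using assms by (auto simp: open_Euclidean_ball_def)
  have cB: "c \<in> B" using c \<open>r > 0\<close> by (simp add: B L2_set_def)
  then show "B \<noteq> {}" by blast
  define seg where "seg x t = (\<lambda>i. c i + t * (x i - c i))" for x and t :: real
  have "connectedin (Euclidean_space n) (seg x ` {0..1})" if "x \<in> B" for x
  proof (rule connectedin_continuous_map_image[where X = euclideanreal])
    show "connectedin euclideanreal {0..1}" by simp
    show "continuous_map euclideanreal (Euclidean_space n) (seg x)"
      unfolding Euclidean_space_def continuous_map_in_subtopology continuous_map_componentwise_UNIV
      using that c by (auto simp: seg_def B topspace_Euclidean_space intro!: continuous_intros)
  qed
  moreover have seg_B: "seg x t \<in> B" if "x \<in> B" "t \<in> {0..1}" for x t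
  proof -
    have "L2_set (\<lambda>i. seg x t i - c i) {..<n} = t * L2_set (\<lambda>i. x i - c i) {..<n}"
      using that(2) by (simp add: seg_def L2_set_right_distrib)
    also have "\<dots> \<le> 1 * L2_set (\<lambda>i. x i - c i) {..<n}"
      using that(2) by (intro mult_right_mono) auto
    also have "\<dots> < r" using that(1) by (simp add: B)
    finally show ?thesis
      using that(1) c by (simp add: B topspace_Euclidean_space) (simp add: seg_def)
  qed
  moreover have ends: "c \<in> seg x ` {0..1}" "x \<in> seg x ` {0..1}" for x
    by (auto simp: seg_def image_iff intro: bexI[of _ 0] bexI[of _ 1])
  moreover have "c \<in> \<Inter>((\<lambda>x. seg x ` {0..1}) ` B)"
    using ends(1) by blast
  ultimately have "connectedin (Euclidean_space n) (\<Union>((\<lambda>x. seg x ` {0..1}) ` B))"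
    by (intro connectedin_Union) blast+
  moreover have "\<Union>((\<lambda>x. seg x ` {0..1}) ` B) = B"
  proof (intro equalityI UN_least image_subsetI subsetI seg_B)
    fix x assume "x \<in> B"
    then show "x \<in> \<Union>((\<lambda>x. seg x ` {0..1}) ` B)" using ends(2) by (rule UN_I)
  qed
  ultimately show "connectedin (Euclidean_space n) B" by simp
qed

section \<open>Transverse coordinates and saturation by plaques\<close>

definition tcoord :: "('a, 'z) fol_chart \<Rightarrow> 'a \<Rightarrow> 'z" where
  "tcoord c x = snd (chart_map c x)"

definition sat :: "('a, 'z) fol_chart \<Rightarrow> 'a set \<Rightarrow> 'a set" where
  "sat c A = \<Union>{P \<in> plaques c. P \<inter> A \<noteq> {}}"

context
  fixes X :: "'a topology" and n :: nat and c :: "('a, 'z) fol_chart"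
  assumes chart: "is_fol_chart X n c"
begin

abbreviation (input) "prodtop \<equiv> prod_topology (subtopology (Euclidean_space n) (chart_ball c)) (chart_trans c)"

lemma chart_dom_open: "openin X (chart_dom c)"
  using chart by (simp add: is_fol_chart_def)

lemma chart_dom_subset: "chart_dom c \<subseteq> topspace X"
  using chart_dom_open by (rule openin_subset)

lemma topspace_chart_ball: "topspace (subtopology (Euclidean_space n) (chart_ball c)) = chart_ball c"
proof -
  have "chart_ball c \<subseteq> topspace (Euclidean_space n)"
    using chart by (auto simp: is_fol_chart_def open_Euclidean_ball_def)
  then show ?thesis by auto
qed

lemma homeomorphic_chart_map: "homeomorphic_map (subtopology X (chart_dom c)) prodtop (chart_map c)"
  using chart by (simp add: is_fol_chart_def)

lemma chart_map_image: "chart_map c ` chart_dom c = chart_ball c \<times> topspace (chart_trans c)"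
  using homeomorphic_imp_surjective_map[OF homeomorphic_chart_map] chart_dom_subset topspace_chart_ball
  by (simp add: topspace_prod_topology Int_absorb1)

lemma chart_map_mem:
  assumes "x \<in> chart_dom c"
  shows "fst (chart_map c x) \<in> chart_ball c" "tcoord c x \<in> topspace (chart_trans c)"
  using chart_map_image assms unfolding tcoord_def by (metis imageI mem_Times_iff)+

lemma chart_ball_nonempty: "chart_ball c \<noteq> {}"
  using chart connectedin_open_Euclidean_ball by (auto simp: is_fol_chart_def)

lemma inj_on_chart_map: "inj_on (chart_map c) (chart_dom c)"
  using homeomorphic_imp_injective_map[OF homeomorphic_chart_map] chart_dom_subset
  by (simp add: Int_absorb1)

text \<open>Plaques are the fibres of the transverse coordinate. They may be indexed by points of
  the domain because the ball is nonempty, so that every point of the transversal is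
  attained.\<close>

lemma plaques_eq: "plaques c = (\<lambda>y. {x \<in> chart_dom c. tcoord c x = tcoord c y}) ` chart_dom c"
proof -
  have 1: "{x \<in> chart_dom c. chart_map c x \<in> chart_ball c \<times> {z}} = {x \<in> chart_dom c. tcoord c x = z}" for z
  proof -
    have "chart_map c x \<in> chart_ball c \<times> {z} \<longleftrightarrow> tcoord c x = z" if "x \<in> chart_dom c" for x
      using chart_map_mem[OF that] by (auto simp: tcoord_def mem_Times_iff)
    then show ?thesis by (intro Collect_cong conj_cong refl)
  qed
  have 2: "topspace (chart_trans c) = tcoord c ` chart_dom c"
  proof -
    have "tcoord c ` chart_dom c = snd ` (chart_map c ` chart_dom c)"
      by (auto simp: tcoord_def)
    then show ?thesis
      unfolding chart_map_image using chart_ball_nonempty by simp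
  qed
  show ?thesis
    unfolding plaques_def 1 2 by auto
qed

lemma plaque_eqI: "P \<in> plaques c \<Longrightarrow> x \<in> P \<Longrightarrow> P = {y \<in> chart_dom c. tcoord c y = tcoord c x}"
  by (auto simp: plaques_eq)

lemma plaque_of_point: "x \<in> chart_dom c \<Longrightarrow> \<exists>P\<in>plaques c. x \<in> P"
  by (auto simp: plaques_eq)

lemma plaque_subset_dom: "P \<in> plaques c \<Longrightarrow> P \<subseteq> chart_dom c"
  by (auto simp: plaques_eq)

lemma plaque_nonempty: "P \<in> plaques c \<Longrightarrow> P \<noteq> {}"
  by (auto simp: plaques_eq)

lemma continuous_map_tcoord: "continuous_map (subtopology X (chart_dom c)) (chart_trans c) (tcoord c)"
proof -
  have "tcoord c = snd \<circ> chart_map c" by (auto simp: tcoord_def)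
  then show ?thesis
    using continuous_map_compose[OF homeomorphic_imp_continuous_map[OF homeomorphic_chart_map] continuous_map_snd]
    by simp
qed

lemma open_map_tcoord: "open_map (subtopology X (chart_dom c)) (chart_trans c) (tcoord c)"
proof -
  have "tcoord c = snd \<circ> chart_map c" by (auto simp: tcoord_def)
  then show ?thesis
    using open_map_compose[OF homeomorphic_imp_open_map[OF homeomorphic_chart_map] open_map_snd]
    by simp
qed

lemma openin_tcoord_preimage:
  assumes "openin (chart_trans c) O'"
  shows "openin X {x \<in> chart_dom c. tcoord c x \<in> O'}"
proof -
  have "openin (subtopology X (chart_dom c)) {x \<in> chart_dom c. tcoord c x \<in> O'}"
    using openin_continuous_map_preimage[OF continuous_map_tcoord assms] chart_dom_subset
    by (simp add: Int_absorb1)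
  then show ?thesis
    using openin_trans_full chart_dom_open by blast
qed

lemma sat_eq: "sat c A = {x \<in> chart_dom c. tcoord c x \<in> tcoord c ` (A \<inter> chart_dom c)}"
  unfolding sat_def plaques_eq
  by (auto simp: image_iff) (metis IntI)+

text \<open>The transverse coordinate is an open map, being a homeomorphism followed by the
  projection of a product. This is why following plaques backwards preserves openness.\<close>

lemma openin_sat:
  assumes "openin X A"
  shows "openin X (sat c A)"
proof -
  have "openin (subtopology X (chart_dom c)) (A \<inter> chart_dom c)"
    using assms by (auto simp: openin_subtopology)
  then show ?thesis
    unfolding sat_eq using open_map_tcoord openin_tcoord_preimage by (simp add: open_map_def)
qed

lemma Hausdorff_chart_trans: "Hausdorff_space (chart_trans c)"
  using chart metrizable_imp_Hausdorff_space completely_metrizable_imp_metrizable_space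
  by (auto simp: is_fol_chart_def Polish_space_def)

lemma fol_change_tcoord:
  assumes "fol_change X n c c'" "x \<in> chart_dom c" "x \<in> chart_dom c'"
  shows "\<exists>W. openin X W \<and> x \<in> W \<and> W \<subseteq> chart_dom c \<inter> chart_dom c' \<and>
    (\<forall>y\<in>W. \<forall>y'\<in>W. tcoord c y = tcoord c y' \<longrightarrow> tcoord c' y = tcoord c' y')"
proof -
  obtain W f h where W: "openin prodtop W" "chart_map c x \<in> W"
      "W \<subseteq> chart_map c ` (chart_dom c \<inter> chart_dom c')"
    and fh: "\<And>a z. (a, z) \<in> W \<Longrightarrow>
      chart_map c' (inv_into (chart_dom c) (chart_map c) (a, z)) = (f (a, z), h z)"
    using assms unfolding fol_change_def by (metis (no_types, lifting) Int_iff imageI)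
  let ?W = "{y \<in> chart_dom c. chart_map c y \<in> W}"
  have "openin (subtopology X (chart_dom c)) ?W"
    using openin_continuous_map_preimage[OF homeomorphic_imp_continuous_map[OF homeomorphic_chart_map] W(1)]
      chart_dom_subset by (simp add: Int_absorb1)
  then have "openin X ?W"
    using openin_trans_full chart_dom_open by blast
  moreover have "tcoord c' y = h (tcoord c y)" if "y \<in> ?W" for y
    using that fh[of "fst (chart_map c y)" "snd (chart_map c y)"]
    by (simp add: inv_into_f_f[OF inj_on_chart_map] tcoord_def)
  moreover have "?W \<subseteq> chart_dom c'"
  proof
    fix y assume y: "y \<in> ?W"
    then obtain y' where "chart_map c y = chart_map c y'" "y' \<in> chart_dom c" "y' \<in> chart_dom c'"
      using W(3) by blast
    then show "y \<in> chart_dom c'"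
      using inj_on_chart_map y by (auto dest: inj_onD)
  qed
  ultimately show ?thesis
    using W(2) assms(2) by (intro exI[of _ ?W]) auto
qed

end

text \<open>Compatible charts are defined by their relation to \<open>\<F>\<close>, not to each
  other, so the two changes of coordinates are composed through a chart of \<open>\<F>\<close>
  around \<open>x\<close>.\<close>

lemma fol_charts_tcoord:
  assumes F: "fol_atlas X n \<F>" and c: "c \<in> fol_charts X n \<F>" "c' \<in> fol_charts X n \<F>"
    and x: "x \<in> chart_dom c" "x \<in> chart_dom c'"
  shows "\<exists>W. openin X W \<and> x \<in> W \<and> W \<subseteq> chart_dom c \<inter> chart_dom c' \<and>
    (\<forall>y\<in>W. \<forall>y'\<in>W. tcoord c y = tcoord c y' \<longrightarrow> tcoord c' y = tcoord c' y')"
proof -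
  have "x \<in> topspace X"
    using chart_dom_subset[of X n c] c(1) x(1) by (auto simp: fol_charts_def)
  then obtain e where e: "e \<in> \<F>" "x \<in> chart_dom e" "is_fol_chart X n e"
    using F unfolding fol_atlas_def by blast
  have ce: "is_fol_chart X n c" "fol_change X n c e" "fol_change X n e c'"
    using c e(1) by (auto simp: fol_charts_def)
  obtain W1 where W1: "openin X W1" "x \<in> W1" "W1 \<subseteq> chart_dom c \<inter> chart_dom e"
    "\<forall>y\<in>W1. \<forall>y'\<in>W1. tcoord c y = tcoord c y' \<longrightarrow> tcoord e y = tcoord e y'"
    using fol_change_tcoord[OF ce(1,2) x(1) e(2)] by blast
  obtain W2 where W2: "openin X W2" "x \<in> W2" "W2 \<subseteq> chart_dom e \<inter> chart_dom c'"
    "\<forall>y\<in>W2. \<forall>y'\<in>W2. tcoord e y = tcoord e y' \<longrightarrow> tcoord c' y = tcoord c' y'"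
    using fol_change_tcoord[OF e(3) ce(3) e(2) x(2)] by blast
  show ?thesis
    by (intro exI[of _ "W1 \<inter> W2"] conjI ballI impI openin_Int W1(1) W2(1)) (use W1(2-) W2(2-) in blast)+
qed

text \<open>Connectedness is claimed in the leaf topology, where plaques of every compatible chart
  are open. The parametrisation of \<open>P\<close> by the ball is still continuous, because the
  transverse coordinate of any other chart is locally constant along \<open>P\<close>.\<close>

lemma connectedin_plaque:
  assumes F: "fol_atlas X n \<F>" and c: "c \<in> fol_charts X n \<F>" and P: "P \<in> plaques c"
  shows "connectedin (leaf_topology X n \<F>) P"
proof -
  have chart: "is_fol_chart X n c" using c by (simp add: fol_charts_def)
  obtain y where y: "y \<in> chart_dom c" and Py: "P = {x \<in> chart_dom c. tcoord c x = tcoord c y}"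
    using P by (auto simp: plaques_eq[OF chart])
  let ?B = "subtopology (Euclidean_space n) (chart_ball c)"
  have tB: "topspace ?B = chart_ball c" by (rule topspace_chart_ball[OF chart])
  obtain \<psi> where \<psi>: "homeomorphic_maps (subtopology X (chart_dom c)) (prod_topology ?B (chart_trans c)) (chart_map c) \<psi>"
    using homeomorphic_chart_map[OF chart] homeomorphic_map_maps by blast
  define g where "g b = \<psi> (b, tcoord c y)" for b
  have ty: "tcoord c y \<in> topspace (chart_trans c)"
    by (rule chart_map_mem(2)[OF chart y])
  have "continuous_map ?B (subtopology X (chart_dom c)) g"
  proof -
    have "continuous_map ?B (prod_topology ?B (chart_trans c)) (\<lambda>b. (b, tcoord c y))"
      using ty by (simp add: continuous_map_paired)
    then show ?thesis
      using continuous_map_compose \<psi> unfolding homeomorphic_maps_def g_def comp_def by fast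
  qed
  then have contg: "continuous_map ?B X g" and g_dom: "\<And>b. b \<in> chart_ball c \<Longrightarrow> g b \<in> chart_dom c"
    using tB by (auto simp: continuous_map_in_subtopology)
  have cg: "chart_map c (g b) = (b, tcoord c y)" if "b \<in> chart_ball c" for b
    using \<psi> that ty tB by (simp add: homeomorphic_maps_def g_def del: topspace_subtopology)
  have gP: "g ` chart_ball c = P"
  proof (intro equalityI subsetI)
    fix x assume "x \<in> g ` chart_ball c"
    then show "x \<in> P" using cg g_dom by (auto simp: Py tcoord_def)
  next
    fix x assume x: "x \<in> P"
    then have xd: "x \<in> chart_dom c" "tcoord c x = tcoord c y" by (auto simp: Py)
    let ?b = "fst (chart_map c x)"
    have b: "?b \<in> chart_ball c"
      by (rule chart_map_mem(1)[OF chart xd(1)])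
    have "chart_map c (g ?b) = chart_map c x"
      using cg[OF b] xd(2) by (simp add: tcoord_def prod_eq_iff)
    then have "g ?b = x"
      using inj_onD[OF inj_on_chart_map[OF chart]] g_dom[OF b] xd(1) by blast
    then show "x \<in> g ` chart_ball c" using b by (metis imageI)
  qed
  have "continuous_map ?B (leaf_topology X n \<F>) g"
    unfolding leaf_topology_def
  proof (rule continuous_on_generated_topo)
    show "g ` topspace ?B \<subseteq> \<Union> (\<Union>c\<in>fol_charts X n \<F>. plaques c)"
      using gP P c unfolding tB by blast
  next
    fix Q assume "Q \<in> (\<Union>c\<in>fol_charts X n \<F>. plaques c)"
    then obtain c' where c': "c' \<in> fol_charts X n \<F>" "Q \<in> plaques c'" by blast
    then have chart': "is_fol_chart X n c'" by (simp add: fol_charts_def)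
    show "openin ?B (g -` Q \<inter> topspace ?B)"
    proof (subst openin_subopen, intro ballI)
      fix b assume b: "b \<in> g -` Q \<inter> topspace ?B"
      then have bB: "b \<in> chart_ball c" and gb: "g b \<in> Q" using tB by blast+
      obtain W where W: "openin X W" "g b \<in> W" "W \<subseteq> chart_dom c \<inter> chart_dom c'"
        "\<forall>y\<in>W. \<forall>y'\<in>W. tcoord c y = tcoord c y' \<longrightarrow> tcoord c' y = tcoord c' y'"
        using fol_charts_tcoord[OF F c c'(1) g_dom[OF bB]] plaque_subset_dom[OF chart' c'(2)] gb by blast
      have "openin ?B {b \<in> topspace ?B. g b \<in> W}"
        by (rule openin_continuous_map_preimage[OF contg W(1)])
      moreover have "{b \<in> topspace ?B. g b \<in> W} \<subseteq> g -` Q \<inter> topspace ?B"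
      proof
        fix b' assume "b' \<in> {b \<in> topspace ?B. g b \<in> W}"
        then have b': "b' \<in> chart_ball c" "g b' \<in> W" using tB by blast+
        then have "tcoord c (g b') = tcoord c (g b)"
          using cg bB by (simp add: tcoord_def)
        then have "tcoord c' (g b') = tcoord c' (g b)"
          using W(2,4) b'(2) by blast
        then have "g b' \<in> Q"
          using plaque_eqI[OF chart' c'(2) gb] b'(2) W(3) by blast
        then show "b' \<in> g -` Q \<inter> topspace ?B" using b'(1) tB by blast
      qed
      ultimately show "\<exists>T. openin ?B T \<and> b \<in> T \<and> T \<subseteq> g -` Q \<inter> topspace ?B"
        using b W(2) by blast
    qed
  qed
  moreover have "connectedin ?B (chart_ball c)"
    using chart connectedin_open_Euclidean_ball(1)
    by (auto simp: is_fol_chart_def connectedin_subtopology)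
  ultimately show ?thesis
    using connectedin_continuous_map_image gP by metis
qed

section \<open>The leaf metric and the graph of plaques\<close>

locale regular_foliated_space =
  fixes X :: "'a topology" and n :: nat and \<F> \<U> :: "('a, 'z) fol_chart set"
  assumes foliated: "compact_Polish_foliated_space X n \<F>"
    and regular: "regular_fol_atlas X n \<F> \<U>"
begin

abbreviation leaf_top :: "'a topology" where "leaf_top \<equiv> leaf_topology X n \<F>"

abbreviation leaf_dist :: "'a \<Rightarrow> 'a \<Rightarrow> real" where "leaf_dist \<equiv> plaque_dist X n \<F> \<U>"

text \<open>Local finiteness does not limit the number of charts with empty domain. They carry no
  plaques and are discarded, so that words are written over a finite alphabet.\<close>

definition charts :: "('a, 'z) fol_chart set" where
  "charts = {c \<in> \<U>. chart_dom c \<noteq> {}}"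

text \<open>
  One set may be a plaque of several charts, so a vertex is a plaque together with its chart.
  Distinctness of two vertices over the same chart is then an open condition, because
  transversals are Hausdorff.
\<close>

definition verts :: "(('a, 'z) fol_chart \<times> 'a set) set" where
  "verts = Sigma \<U> plaques"

text \<open>Every vertex is adjacent to itself, as plaques are nonempty. Hence
  \<open>adj ^^ k\<close> describes balls of radius \<open>k\<close>, not only walks without
  pauses.\<close>

definition adj :: "((('a, 'z) fol_chart \<times> 'a set) \<times> ('a, 'z) fol_chart \<times> 'a set) set" where
  "adj = {(v, u). v \<in> verts \<and> u \<in> verts \<and> snd v \<inter> snd u \<noteq> {}}"

definition leaf_verts :: "'a set \<Rightarrow> (('a, 'z) fol_chart \<times> 'a set) set" where
  "leaf_verts L = {v \<in> verts. snd v \<subseteq> L}"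

lemma fol_atlas: "fol_atlas X n \<F>"
  using foliated by (simp add: compact_Polish_foliated_space_def)

lemma atlas_fol_charts: "c \<in> \<U> \<Longrightarrow> c \<in> fol_charts X n \<F>"
  using regular by (auto simp: regular_fol_atlas_def)

lemma atlas_is_fol_chart: "c \<in> \<U> \<Longrightarrow> is_fol_chart X n c"
  using atlas_fol_charts by (auto simp: fol_charts_def)

lemma vert_plaque: "v \<in> verts \<Longrightarrow> fst v \<in> \<U> \<and> snd v \<in> plaques (fst v)"
  by (auto simp: verts_def)

lemma vert_nonempty: "v \<in> verts \<Longrightarrow> snd v \<noteq> {}"
  using vert_plaque plaque_nonempty atlas_is_fol_chart by metis

lemma vert_subset: "v \<in> verts \<Longrightarrow> snd v \<subseteq> topspace X"
  using vert_plaque plaque_subset_dom chart_dom_subset atlas_is_fol_chart by (metis order_trans)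

lemma vert_chart: "v \<in> verts \<Longrightarrow> fst v \<in> charts"
  using vert_plaque[of v] vert_nonempty[of v] plaque_subset_dom[OF atlas_is_fol_chart, of "fst v" "snd v"]
  unfolding charts_def by auto

lemma vert_of_point: "x \<in> topspace X \<Longrightarrow> \<exists>v\<in>verts. x \<in> snd v"
proof -
  assume "x \<in> topspace X"
  moreover have "topspace X = (\<Union>c\<in>\<U>. chart_dom c)"
    using regular by (simp add: regular_fol_atlas_def fol_atlas_def)
  ultimately obtain c where "c \<in> \<U>" "x \<in> chart_dom c" by blast
  then show ?thesis
    using plaque_of_point[OF atlas_is_fol_chart] by (fastforce simp: verts_def)
qed

text \<open>A plaque lies in its closure, so the closure condition of regularity applies. It enters
  the proof only in this form, as determinism of continuation from one chart to the next.\<close>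

lemma plaque_unique:
  assumes "c \<in> \<U>" "c' \<in> \<U>" "P \<in> plaques c" "Q \<in> plaques c'" "Q' \<in> plaques c'"
    and "P \<inter> Q \<noteq> {}" "P \<inter> Q' \<noteq> {}"
  shows "Q = Q'"
proof -
  have sub: "R \<subseteq> X closure_of R" if "e \<in> \<U>" "R \<in> plaques e" for e R
    using vert_subset[of "(e, R)"] that by (intro closure_of_subset) (auto simp: verts_def)
  have "X closure_of P \<inter> X closure_of Q \<noteq> {} \<and> X closure_of P \<inter> X closure_of Q' \<noteq> {}"
    using sub[OF assms(1,3)] sub[OF assms(2,4)] sub[OF assms(2,5)] assms(6,7) by blast
  then show ?thesis
    using regular assms(1-5) unfolding regular_fol_atlas_def by blast
qed

lemma finite_charts: "finite charts"
proof -
  define \<N> where "\<N> = {N. openin X N \<and> finite {c \<in> \<U>. chart_dom c \<inter> N \<noteq> {}}}"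
  have "topspace X \<subseteq> \<Union>\<N>"
  proof
    fix x assume "x \<in> topspace X"
    moreover have "\<forall>x\<in>topspace X. \<exists>N. openin X N \<and> x \<in> N \<and> finite {c \<in> \<U>. chart_dom c \<inter> N \<noteq> {}}"
      using regular by (simp add: regular_fol_atlas_def)
    ultimately obtain N where "openin X N" "x \<in> N" "finite {c \<in> \<U>. chart_dom c \<inter> N \<noteq> {}}"
      by (meson bspec)
    then show "x \<in> \<Union>\<N>" by (auto simp: \<N>_def)
  qed
  moreover have "compactin X (topspace X)"
    using foliated by (simp add: compact_Polish_foliated_space_def compact_space_def)
  moreover have "\<And>N. N \<in> \<N> \<Longrightarrow> openin X N" by (simp add: \<N>_def)
  ultimately obtain \<N>' where N: "finite \<N>'" "\<N>' \<subseteq> \<N>" "topspace X \<subseteq> \<Union>\<N>'"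
    by (meson compactinD)
  have "charts \<subseteq> (\<Union>N\<in>\<N>'. {c \<in> \<U>. chart_dom c \<inter> N \<noteq> {}})"
  proof
    fix c assume c: "c \<in> charts"
    then obtain y where y: "y \<in> chart_dom c" "c \<in> \<U>" by (auto simp: charts_def)
    then have "y \<in> topspace X"
      using chart_dom_subset[OF atlas_is_fol_chart] by blast
    then obtain N' where "N' \<in> \<N>'" "y \<in> N'" using N(3) by blast
    then show "c \<in> (\<Union>N\<in>\<N>'. {c \<in> \<U>. chart_dom c \<inter> N \<noteq> {}})"
      using y by auto
  qed
  moreover have "finite (\<Union>N\<in>\<N>'. {c \<in> \<U>. chart_dom c \<inter> N \<noteq> {}})"
    using N(1,2) by (intro finite_UN_I) (auto simp: \<N>_def)
  ultimately show ?thesis by (rule finite_subset)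
qed

lemma adj_refl: "v \<in> verts \<Longrightarrow> (v, v) \<in> adj"
  using vert_nonempty by (simp add: adj_def)

lemma sym_adj: "sym adj"
  by (auto simp: adj_def sym_def)

lemma adj_closed: "adj `` verts \<subseteq> verts"
  by (auto simp: adj_def)

text \<open>Each chart contributes at most one neighbour by \<open>plaque_unique\<close>, and only
  finitely many charts have nonempty domain.\<close>

lemma finite_adj: "finite (adj `` {v})"
proof (rule inj_on_finite[OF _ _ finite_charts])
  show "fst ` (adj `` {v}) \<subseteq> charts"
    using vert_chart by (auto simp: adj_def)
  show "inj_on fst (adj `` {v})"
  proof (rule inj_onI)
    fix u w assume "u \<in> adj `` {v}" "w \<in> adj `` {v}" "fst u = fst w"
    moreover from this have "snd u = snd w"
      using vert_plaque[of u] vert_plaque[of v] vert_plaque[of w]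
      by (intro plaque_unique[of "fst v" "fst u" "snd v" "snd u" "snd w"]) (simp_all add: adj_def)
    ultimately show "u = w" by (simp add: prod_eq_iff)
  qed
qed

section \<open>The leaf topology and the vertices of a leaf\<close>

lemma topspace_leaf_top: "topspace leaf_top = topspace X"
proof
  show "topspace leaf_top \<subseteq> topspace X"
    unfolding leaf_topology_def topology_generated_by_topspace fol_charts_def
    using plaque_subset_dom chart_dom_subset by fast
  show "topspace X \<subseteq> topspace leaf_top"
  proof
    fix x assume "x \<in> topspace X"
    then obtain v where "v \<in> verts" "x \<in> snd v" using vert_of_point by blast
    then show "x \<in> topspace leaf_top"
      unfolding leaf_topology_def topology_generated_by_topspace
      using vert_plaque atlas_fol_charts by blast
  qed
qed

lemma openin_leaf_top_vert:
  assumes "v \<in> verts" shows "openin leaf_top (snd v)"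
proof -
  have "snd v \<in> (\<Union>c\<in>fol_charts X n \<F>. plaques c)"
    using vert_plaque[OF assms] atlas_fol_charts by blast
  then show ?thesis
    unfolding leaf_topology_def by (rule topology_generated_by_Basis)
qed

lemma connectedin_vert: "v \<in> verts \<Longrightarrow> connectedin leaf_top (snd v)"
  using connectedin_plaque[OF fol_atlas atlas_fol_charts] vert_plaque by blast

lemma leaf_connected: "L \<in> leaves X n \<F> \<Longrightarrow> connectedin leaf_top L"
  using connectedin_connected_components_of by (simp add: leaves_def)

lemma leaf_nonempty: "L \<in> leaves X n \<F> \<Longrightarrow> L \<noteq> {}"
  using nonempty_connected_components_of by (simp add: leaves_def)

lemma leaf_subset: "L \<in> leaves X n \<F> \<Longrightarrow> L \<subseteq> topspace X"
  using connectedin_subset_topspace[OF leaf_connected] topspace_leaf_top by simp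

lemma Union_leaves: "\<Union>(leaves X n \<F>) = topspace X"
  by (simp add: leaves_def Union_connected_components_of topspace_leaf_top)

lemma leaves_disjoint: "L \<in> leaves X n \<F> \<Longrightarrow> L' \<in> leaves X n \<F> \<Longrightarrow> L \<inter> L' \<noteq> {} \<Longrightarrow> L = L'"
  using connected_components_of_overlap by (metis leaves_def)

lemma leaf_vertsI:
  assumes "L \<in> leaves X n \<F>" "v \<in> verts" "snd v \<inter> L \<noteq> {}"
  shows "v \<in> leaf_verts L"
proof -
  have "snd v \<subseteq> L"
    using assms connectedin_vert[OF assms(2)] connected_components_of_maximal
    unfolding leaves_def by (metis disjnt_def inf_commute)
  then show ?thesis using assms(2) by (simp add: leaf_verts_def)
qed

lemma leaf_vert_of_point:
  assumes "L \<in> leaves X n \<F>" "x \<in> L"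
  shows "\<exists>v\<in>leaf_verts L. x \<in> snd v"
proof -
  obtain v where "v \<in> verts" "x \<in> snd v"
    using vert_of_point leaf_subset[OF assms(1)] assms(2) by blast
  then show ?thesis using leaf_vertsI[OF assms(1)] assms(2) by blast
qed

lemma adj_leaf_verts: "L \<in> leaves X n \<F> \<Longrightarrow> adj `` leaf_verts L \<subseteq> leaf_verts L"
  using leaf_vertsI unfolding adj_def leaf_verts_def by fast

lemma Union_leaf_verts: "L \<in> leaves X n \<F> \<Longrightarrow> \<Union>(snd ` leaf_verts L) = L"
  using leaf_vert_of_point by (auto simp: leaf_verts_def)

text \<open>If \<open>u\<close> could not be reached from \<open>v\<close>, the reachable and the
  unreachable plaques would have disjoint unions, open in the leaf topology, and so separate a
  connected set.\<close>

lemma connected_Union_path: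
  assumes S: "S \<subseteq> verts" "connectedin leaf_top (\<Union>(snd ` S))" and v: "v \<in> S" and u: "u \<in> S"
  shows "(v, u) \<in> (adj \<inter> S \<times> S)\<^sup>*"
proof (rule ccontr)
  let ?R = "adj \<inter> S \<times> S"
  assume vu: "(v, u) \<notin> ?R\<^sup>*"
  define A where "A = \<Union>(snd ` {w \<in> S. (v, w) \<in> ?R\<^sup>*})"
  define B where "B = \<Union>(snd ` {w \<in> S. (v, w) \<notin> ?R\<^sup>*})"
  have "openin leaf_top A" "openin leaf_top B"
    unfolding A_def B_def using S(1) openin_leaf_top_vert by (auto intro!: openin_Union)
  moreover have "A \<inter> B = {}"
  proof (rule ccontr)
    assume "A \<inter> B \<noteq> {}"
    then obtain x where x: "x \<in> A" "x \<in> B" by blast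
    obtain w where w: "w \<in> S" "(v, w) \<in> ?R\<^sup>*" "x \<in> snd w"
      using x(1) unfolding A_def by blast
    obtain w' where w': "w' \<in> S" "(v, w') \<notin> ?R\<^sup>*" "x \<in> snd w'"
      using x(2) unfolding B_def by blast
    have "(w, w') \<in> ?R" using S(1) w w' by (auto simp: adj_def)
    then show False using w(2) w'(2) by (meson rtrancl.rtrancl_into_rtrancl)
  qed
  moreover have "\<Union>(snd ` S) \<subseteq> A \<union> B" by (auto simp: A_def B_def)
  ultimately have "A \<inter> \<Union>(snd ` S) = {} \<or> B \<inter> \<Union>(snd ` S) = {}"
    using S(2) unfolding connectedin by blast
  moreover have "snd v \<subseteq> A \<inter> \<Union>(snd ` S)" "snd u \<subseteq> B \<inter> \<Union>(snd ` S)"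
    using v u vu by (auto simp: A_def B_def)
  moreover have "snd v \<noteq> {}" "snd u \<noteq> {}"
    using v u S(1) vert_nonempty by blast+
  ultimately show False by blast
qed

lemma leaf_path:
  assumes "L \<in> leaves X n \<F>" "v \<in> leaf_verts L" "u \<in> leaf_verts L"
  shows "\<exists>k. (v, u) \<in> adj ^^ k"
proof -
  have "(v, u) \<in> (adj \<inter> leaf_verts L \<times> leaf_verts L)\<^sup>*"
    using assms leaf_connected[OF assms(1)] Union_leaf_verts[OF assms(1)]
    by (intro connected_Union_path) (auto simp: leaf_verts_def)
  then have "(v, u) \<in> adj\<^sup>*" by (meson Int_lower1 rtrancl_mono subsetD)
  then show ?thesis by (rule rtrancl_imp_relpow)
qed

section \<open>Chains of plaques and the leaf metric\<close>

definition plaque_chain :: "nat \<Rightarrow> 'a \<Rightarrow> 'a \<Rightarrow> bool" where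
  "plaque_chain k x y \<longleftrightarrow> (\<exists>\<P> \<subseteq> (\<Union>c \<in> \<U>. plaques c). finite \<P> \<and> card \<P> = k \<and>
     connectedin leaf_top (\<Union>\<P>) \<and> x \<in> \<Union>\<P> \<and> y \<in> \<Union>\<P>)"

lemma plaque_dist_eq: "leaf_dist x y = (if x = y then 0 else real (LEAST k. plaque_chain k x y))"
  unfolding plaque_dist_def plaque_chain_def by simp

lemma plaque_chain_sym: "plaque_chain k x y \<longleftrightarrow> plaque_chain k y x"
  unfolding plaque_chain_def by blast

text \<open>A walk with \<open>k\<close> edges visits at most \<open>k + 1\<close> plaques, and
  fewer when vertices repeat or share a plaque; hence an inequality instead of an exact
  count.\<close>

lemma plaque_chain_of_path:
  assumes "(v, u) \<in> adj ^^ k" "v \<in> verts" "x \<in> snd v" "y \<in> snd u"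
  shows "\<exists>j\<le>Suc k. plaque_chain j x y"
proof -
  have "\<exists>\<P> \<subseteq> snd ` verts. finite \<P> \<and> card \<P> \<le> Suc k \<and> connectedin leaf_top (\<Union>\<P>) \<and> snd v \<in> \<P> \<and> snd u \<in> \<P>"
    using assms(1)
  proof (induction k arbitrary: u)
    case 0
    then show ?case
      using assms(2) connectedin_vert by (intro exI[of _ "{snd v}"]) auto
  next
    case (Suc k)
    then obtain w where w: "(v, w) \<in> adj ^^ k" "(w, u) \<in> adj" by auto
    obtain \<P> where P: "\<P> \<subseteq> snd ` verts" "finite \<P>" "card \<P> \<le> Suc k" "connectedin leaf_top (\<Union>\<P>)"
        "snd v \<in> \<P>" "snd w \<in> \<P>"
      using Suc.IH[OF w(1)] by blast
    have u: "u \<in> verts" and wu: "snd w \<inter> snd u \<noteq> {}" using w(2) by (auto simp: adj_def)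
    have "connectedin leaf_top (snd u \<union> \<Union>\<P>)"
      using connectedin_vert[OF u] P(4,6) wu by (intro connectedin_Un) auto
    then show ?case
      using P u by (intro exI[of _ "insert (snd u) \<P>"]) (auto simp: card_insert_if)
  qed
  moreover have "snd ` verts = (\<Union>c \<in> \<U>. plaques c)"
    by (force simp: verts_def)
  ultimately show ?thesis
    using assms(3,4) unfolding plaque_chain_def by (metis UnionI)
qed

lemma plaque_chain_exists:
  assumes "L \<in> leaves X n \<F>" "x \<in> L" "y \<in> L"
  shows "\<exists>k. plaque_chain k x y"
proof -
  obtain v u where "v \<in> leaf_verts L" "x \<in> snd v" "u \<in> leaf_verts L" "y \<in> snd u"
    using leaf_vert_of_point assms by meson
  then show ?thesis
    using leaf_path[OF assms(1)] plaque_chain_of_path by (metis (no_types, lifting) leaf_verts_def mem_Collect_eq)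
qed

lemma leaf_dist_chain:
  assumes "L \<in> leaves X n \<F>" "x \<in> L" "y \<in> L" "x \<noteq> y"
  shows "\<exists>k>0. leaf_dist x y = real k \<and> plaque_chain k x y"
proof -
  have chain: "plaque_chain (LEAST k. plaque_chain k x y) x y"
    using plaque_chain_exists[OF assms(1-3)] by (meson LeastI_ex)
  \<comment> \<open>The empty union contains no point, so a chain has at least one plaque.\<close>
  then have "(LEAST k. plaque_chain k x y) > 0"
    unfolding plaque_chain_def by (metis Union_empty card_gt_0_iff empty_iff)
  then show ?thesis
    using chain assms(4) by (auto simp: plaque_dist_eq)
qed

lemma leaf_dist_le: "plaque_chain k x y \<Longrightarrow> leaf_dist x y \<le> real k"
  by (auto simp: plaque_dist_eq Least_le)

lemma leaf_dist_ge_1: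
  assumes "L \<in> leaves X n \<F>" "x \<in> L" "y \<in> L" "x \<noteq> y"
  shows "1 \<le> leaf_dist x y"
  using leaf_dist_chain[OF assms] by auto

lemma Metric_space_leaf:
  assumes L: "L \<in> leaves X n \<F>"
  shows "Metric_space L leaf_dist"
proof
  show "0 \<le> leaf_dist x y" for x y by (simp add: plaque_dist_eq)
  show "leaf_dist x y = leaf_dist y x" for x y
    by (auto simp: plaque_dist_eq plaque_chain_sym[of _ x])
  show "leaf_dist x y = 0 \<longleftrightarrow> x = y" if "x \<in> L" "y \<in> L" for x y
    using leaf_dist_ge_1[OF L that] by (auto simp: plaque_dist_eq)
  show "leaf_dist x z \<le> leaf_dist x y + leaf_dist y z" if xyz: "x \<in> L" "y \<in> L" "z \<in> L" for x y z
  \<comment> \<open>Distance 0 is set by definition and not witnessed by a chain, so coinciding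
    points are treated apart.\<close>
  proof (cases "x = y \<or> y = z")
    case True
    then show ?thesis by (auto simp: plaque_dist_eq)
  next
    case False
    obtain k where k: "leaf_dist x y = real k" "plaque_chain k x y"
      using leaf_dist_chain[OF L xyz(1,2)] False by blast
    obtain m where m: "leaf_dist y z = real m" "plaque_chain m y z"
      using leaf_dist_chain[OF L xyz(2,3)] False by blast
    obtain \<P> where P: "\<P> \<subseteq> (\<Union>c \<in> \<U>. plaques c)" "finite \<P>" "card \<P> = k"
        "connectedin leaf_top (\<Union>\<P>)" "x \<in> \<Union>\<P>" "y \<in> \<Union>\<P>"
      using k(2) unfolding plaque_chain_def by blast
    obtain \<Q> where Q: "\<Q> \<subseteq> (\<Union>c \<in> \<U>. plaques c)" "finite \<Q>" "card \<Q> = m"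
        "connectedin leaf_top (\<Union>\<Q>)" "y \<in> \<Union>\<Q>" "z \<in> \<Union>\<Q>"
      using m(2) unfolding plaque_chain_def by blast
    have "connectedin leaf_top (\<Union>\<P> \<union> \<Union>\<Q>)"
      using P Q by (intro connectedin_Un) blast+
    then have "plaque_chain (card (\<P> \<union> \<Q>)) x z"
      unfolding plaque_chain_def using P Q by (intro exI[of _ "\<P> \<union> \<Q>"]) auto
    then have "leaf_dist x z \<le> real (card (\<P> \<union> \<Q>))" by (rule leaf_dist_le)
    also have "\<dots> \<le> real (k + m)"
      using card_Un_le[of \<P> \<Q>] P(3) Q(3) by simp
    finally show ?thesis using k m by simp
  qed
qed

text \<open>Distinct points are at distance at least 1, so balls of radius 1 are single points and
  the metric topology is discrete. The covers built from labels are open for this reason.\<close>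

lemma openin_leaf_dist:
  assumes "L \<in> leaves X n \<F>" "S \<subseteq> L"
  shows "openin (Metric_space.mtopology L leaf_dist) S"
proof -
  note M = Metric_space_leaf[OF assms(1)]
  have "Metric_space.mball L leaf_dist x 1 \<subseteq> S" if "x \<in> S" for x
  proof
    fix y assume "y \<in> Metric_space.mball L leaf_dist x 1"
    then have "x \<in> L" "y \<in> L" "leaf_dist x y < 1" by (auto simp: Metric_space.in_mball[OF M])
    then have "x = y" using leaf_dist_ge_1[OF assms(1)] by fastforce
    then show "y \<in> S" using that by simp
  qed
  then show ?thesis
    unfolding Metric_space.openin_mtopology[OF M] using assms(2) zero_less_one by blast
qed

lemma leaf_dist_le_of_path:
  assumes "(v, u) \<in> adj ^^ k" "v \<in> verts" "x \<in> snd v" "y \<in> snd u"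
  shows "leaf_dist x y \<le> real (Suc k)"
  using plaque_chain_of_path[OF assms] leaf_dist_le by (meson of_nat_mono order_trans)

text \<open>
  A path inside a set of \<open>k\<close> plaques needs at most as many steps as there are pairs of plaques;
  the last two steps connect to the given vertices.
\<close>

lemma path_of_leaf_dist_le:
  assumes L: "L \<in> leaves X n \<F>" and v: "v \<in> verts" "x \<in> snd v" "x \<in> L" and u: "u \<in> verts" "y \<in> snd u" "y \<in> L"
    and d: "leaf_dist x y \<le> real k"
  shows "(v, u) \<in> adj ^^ (k * k + 2)"
proof -
  have "\<exists>m\<le>k * k + 2. (v, u) \<in> adj ^^ m"
  proof (cases "x = y")
    case True
    then have "(v, u) \<in> adj ^^ 1" using v u by (auto simp: adj_def)
    then show ?thesis by (intro exI[of _ 1]) auto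
  next
    case False
    obtain j where j: "leaf_dist x y = real j" "plaque_chain j x y"
      using leaf_dist_chain[OF L v(3) u(3) False] by blast
    have jk: "j \<le> k" using d j(1) by simp
    obtain \<P> where P: "\<P> \<subseteq> (\<Union>c \<in> \<U>. plaques c)" "finite \<P>" "card \<P> = j"
        "connectedin leaf_top (\<Union>\<P>)" "x \<in> \<Union>\<P>" "y \<in> \<Union>\<P>"
      using j(2) unfolding plaque_chain_def by blast
    then have "\<forall>P\<in>\<P>. \<exists>c\<in>\<U>. P \<in> plaques c" by blast
    \<comment> \<open>One plaque can belong to several charts; choosing a chart for each turns the
      chain into a set of at most \<open>j\<close> vertices.\<close>
    then obtain lab where lab: "\<And>P. P \<in> \<P> \<Longrightarrow> lab P \<in> \<U> \<and> P \<in> plaques (lab P)" by metis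
    define S where "S = (\<lambda>P. (lab P, P)) ` \<P>"
    have S: "S \<subseteq> verts" "finite S" "card S \<le> j" and US: "\<Union>(snd ` S) = \<Union>\<P>"
      using lab P(2,3) card_image_le[OF P(2)] by (auto simp: S_def verts_def)
    obtain w w' where w: "w \<in> S" "x \<in> snd w" "w' \<in> S" "y \<in> snd w'"
      using P(5,6) US by (metis UN_E)
    let ?R = "adj \<inter> S \<times> S"
    have "(w, w') \<in> ?R\<^sup>*"
      using connected_Union_path[OF S(1) _ w(1,3)] P(4) US by simp
    moreover have finR: "finite ?R" using S(2) by simp
    ultimately obtain m where m: "m \<le> card ?R" "(w, w') \<in> ?R ^^ m"
      using rtrancl_finite_eq_relpow[OF finR] by auto
    have "card ?R \<le> card (S \<times> S)"
      using S(2) by (intro card_mono) auto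
    also have "\<dots> \<le> k * k"
      using S(3) jk unfolding card_cartesian_product by (intro mult_mono) auto
    finally have mk: "m \<le> k * k" using m(1) by simp
    have "(w, w') \<in> adj ^^ m"
      using m(2) relpow_subset[of ?R adj m] by blast
    moreover have "(v, w) \<in> adj" "(w', u) \<in> adj"
      using w v u S(1) by (auto simp: adj_def)
    ultimately have "(v, u) \<in> adj ^^ (Suc (Suc m))"
      by (meson relpow_Suc_I relpow_Suc_I2)
    then show ?thesis using mk by (intro exI[of _ "Suc (Suc m)"]) auto
  qed
  \<comment> \<open>Loops in \<open>adj\<close> pad a shorter walk to the exact length.\<close>
  then show ?thesis
    using relpow_refl_mono[OF adj_closed adj_refl v(1)] by blast
qed

end

section \<open>Asymptotic dimension of leaves\<close>

lemma has_at_most_mono: "has_at_most S m \<Longrightarrow> m \<le> k \<Longrightarrow> has_at_most S k"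
  by (auto simp: has_at_most_def intro: order_trans)

lemma cover_multiplicity_le_iff:
  "cover_multiplicity M \<V> \<le> k \<longleftrightarrow> (\<forall>x\<in>M. has_at_most {V \<in> \<V>. x \<in> V} k)"
proof
  have "\<forall>x\<in>M. has_at_most {V \<in> \<V>. x \<in> V} (cover_multiplicity M \<V>)"
    unfolding cover_multiplicity_def by (rule LeastI[of _ \<infinity>]) (simp add: has_at_most_def)
  then show "\<forall>x\<in>M. has_at_most {V \<in> \<V>. x \<in> V} k" if "cover_multiplicity M \<V> \<le> k"
    using that has_at_most_mono by blast
  show "cover_multiplicity M \<V> \<le> k" if "\<forall>x\<in>M. has_at_most {V \<in> \<V>. x \<in> V} k"
    unfolding cover_multiplicity_def using that by (rule Least_le)
qed

context regular_foliated_space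
begin

lemma relpow_adj_sym: "(v, u) \<in> adj ^^ k \<Longrightarrow> (u, v) \<in> adj ^^ k"
proof (induction k arbitrary: u)
  case (Suc k)
  from Suc.prems obtain w where w: "(v, w) \<in> adj ^^ k" "(w, u) \<in> adj"
    by (rule relpow_Suc_E)
  show ?case
    by (rule relpow_Suc_I2[OF symD[OF sym_adj w(2)] Suc.IH[OF w(1)]])
qed simp

text \<open>Balls of a fixed radius are coarsened to a bounded cover, whose members become labels.
  Each member is represented by a vertex whose sample point it contains; members sharing a
  representative only lower the number of labels.\<close>

lemma graph_cover_of_leaf_cover:
  assumes L: "L \<in> leaves X n \<F>"
    and cover: "\<And>\<V>. open_cover L leaf_dist \<V> \<Longrightarrow> uniformly_bounded_family leaf_dist \<V> \<Longrightarrow>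
      \<exists>\<W>. open_cover L leaf_dist \<W> \<and> uniformly_bounded_family leaf_dist \<W> \<and> refines \<V> \<W> \<and>
        cover_multiplicity L \<W> \<le> enat N"
  shows "\<exists>D \<sigma>. graph_cover adj (leaf_verts L) N r D \<sigma>"
proof -
  note M = Metric_space_leaf[OF L]
  \<comment> \<open>A walk of \<open>r\<close> edges moves a point by at most \<open>r + 1\<close>,
    hence the radius \<open>Suc r\<close>.\<close>
  define \<V> where "\<V> = (\<lambda>x. {y \<in> L. leaf_dist x y \<le> real (Suc r)}) ` L"
  have "open_cover L leaf_dist \<V>"
    unfolding open_cover_def
  proof
    show "\<forall>V\<in>\<V>. openin (Metric_space.mtopology L leaf_dist) V"
      using openin_leaf_dist[OF L] by (auto simp: \<V>_def)
    have "x \<in> {y \<in> L. leaf_dist x y \<le> real (Suc r)}" if "x \<in> L" for x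
      using that by (simp add: plaque_dist_eq)
    then show "\<Union>\<V> = L" unfolding \<V>_def by blast
  qed
  moreover have "leaf_dist y z \<le> real (2 * Suc r)"
    if "V \<in> \<V>" "y \<in> V" "z \<in> V" for V y z
  proof -
    obtain x where x: "x \<in> L" "y \<in> L" "z \<in> L" "leaf_dist x y \<le> real (Suc r)" "leaf_dist x z \<le> real (Suc r)"
      using \<open>V \<in> \<V>\<close> \<open>y \<in> V\<close> \<open>z \<in> V\<close> by (auto simp: \<V>_def)
    then show ?thesis
      using Metric_space.triangle[OF M x(2,1,3)] Metric_space.commute[OF M, of x y] by simp
  qed
  then have "uniformly_bounded_family leaf_dist \<V>"
    unfolding uniformly_bounded_family_def by (intro exI[of _ "real (2 * Suc r)"]) simp
  ultimately obtain \<W> where \<W>: "open_cover L leaf_dist \<W>" "uniformly_bounded_family leaf_dist \<W>"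
      "refines \<V> \<W>" "cover_multiplicity L \<W> \<le> enat N"
    using cover by blast
  obtain D0 where D0: "\<And>W x y. W \<in> \<W> \<Longrightarrow> x \<in> W \<Longrightarrow> y \<in> W \<Longrightarrow> leaf_dist x y \<le> D0"
    using \<W>(2) unfolding uniformly_bounded_family_def by blast
  define k where "k = nat \<lceil>D0\<rceil>"
  have k: "D0 \<le> real k" unfolding k_def by linarith
  define p where "p v = (SOME x. x \<in> snd v)" for v :: "('a, 'z) fol_chart \<times> 'a set"
  have p: "p v \<in> snd v" "p v \<in> L" "v \<in> verts" if "v \<in> leaf_verts L" for v
    using that vert_nonempty some_in_eq[of "snd v"] by (auto simp: p_def leaf_verts_def)
  define ctr where "ctr W = (SOME v. v \<in> leaf_verts L \<and> p v \<in> W)" for W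
  have ctr: "ctr W \<in> leaf_verts L" "p (ctr W) \<in> W" if "v \<in> leaf_verts L" "p v \<in> W" for v W
    using someI[of "\<lambda>v. v \<in> leaf_verts L \<and> p v \<in> W"] that unfolding ctr_def by blast+
  define \<sigma> where "\<sigma> v = ctr ` {W \<in> \<W>. p v \<in> W}" for v
  \<comment> \<open>The exponent is the walk length that \<open>path_of_leaf_dist_le\<close> assigns
    to distance \<open>k\<close>.\<close>
  have "graph_cover adj (leaf_verts L) N r (k * k + 2) \<sigma>"
    unfolding graph_cover_def
  proof (intro ballI conjI)
    fix v assume v: "v \<in> leaf_verts L"
    show "\<sigma> v \<subseteq> (adj ^^ (k * k + 2)) `` {v}"
    proof
      fix a assume "a \<in> \<sigma> v"
      then obtain W where W: "W \<in> \<W>" "p v \<in> W" "a = ctr W" by (auto simp: \<sigma>_def)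
      note a = ctr[OF v W(2)]
      have "leaf_dist (p v) (p a) \<le> real k"
        using D0[OF W(1,2) a(2)] k W(3) by simp
      then have "(v, a) \<in> adj ^^ (k * k + 2)"
        using p[OF v] p[OF a(1)] W(3) by (intro path_of_leaf_dist_le[OF L]) auto
      then show "a \<in> (adj ^^ (k * k + 2)) `` {v}" by simp
    qed
    have "has_at_most {W \<in> \<W>. p v \<in> W} (enat N)"
      using \<W>(4) p(2)[OF v] unfolding cover_multiplicity_le_iff by blast
    then have fin: "finite {W \<in> \<W>. p v \<in> W}" "card {W \<in> \<W>. p v \<in> W} \<le> N"
      by (simp_all add: has_at_most_def)
    then show "card (\<sigma> v) \<le> N"
      unfolding \<sigma>_def using card_image_le order_trans by blast
    have "{y \<in> L. leaf_dist (p v) y \<le> real (Suc r)} \<in> \<V>"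
      using p(2)[OF v] by (simp add: \<V>_def)
    then obtain W where W: "W \<in> \<W>" "{y \<in> L. leaf_dist (p v) y \<le> real (Suc r)} \<subseteq> W"
      using \<W>(3) unfolding refines_def by blast
    show "\<exists>a. \<forall>u\<in>(adj ^^ r) `` {v}. a \<in> \<sigma> u"
    proof (intro exI ballI)
      fix u assume "u \<in> (adj ^^ r) `` {v}"
      then have vu: "(v, u) \<in> adj ^^ r" by simp
      then have u: "u \<in> leaf_verts L" using relpow_closed[OF adj_leaf_verts[OF L] v] by blast
      have "leaf_dist (p v) (p u) \<le> real (Suc r)"
        using p[OF v] p[OF u] by (intro leaf_dist_le_of_path[OF vu]) auto
      then have "p u \<in> W" using W(2) p(2)[OF u] by blast
      then show "ctr W \<in> \<sigma> u" using W(1) by (auto simp: \<sigma>_def)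
    qed
  qed
  then show ?thesis by blast
qed

text \<open>Labels are turned back into sets: \<open>W a\<close> collects the points whose chosen
  vertex carries the label \<open>a\<close>, so the multiplicity at \<open>x\<close> is at most the
  number of labels of \<open>q x\<close>.\<close>

lemma leaf_cover_of_graph_cover:
  assumes L: "L \<in> leaves X n \<F>"
    and cover: "\<And>r. \<exists>D \<sigma>. graph_cover adj (leaf_verts L) N r D \<sigma>"
    and \<V>: "open_cover L leaf_dist \<V>" "uniformly_bounded_family leaf_dist \<V>"
  shows "\<exists>\<W>. open_cover L leaf_dist \<W> \<and> uniformly_bounded_family leaf_dist \<W> \<and> refines \<V> \<W> \<and>
        cover_multiplicity L \<W> \<le> enat N"
proof -
  obtain D0 where D0: "\<And>V x y. V \<in> \<V> \<Longrightarrow> x \<in> V \<Longrightarrow> y \<in> V \<Longrightarrow> leaf_dist x y \<le> D0"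
    using \<V>(2) unfolding uniformly_bounded_family_def by blast
  define k where "k = nat \<lceil>D0\<rceil>"
  have k: "D0 \<le> real k" unfolding k_def by linarith
  have VL: "V \<subseteq> L" if "V \<in> \<V>" for V using \<V>(1) that by (auto simp: open_cover_def)
  \<comment> \<open>Points at distance at most \<open>k\<close> have chosen vertices within
    \<open>k * k + 2\<close> steps, so this radius provides a common label for each nonempty member
    of \<open>\<V>\<close>.\<close>
  obtain D \<sigma> where "graph_cover adj (leaf_verts L) N (k * k + 2) D \<sigma>"
    using cover by blast
  then have \<sigma>: "\<And>v. v \<in> leaf_verts L \<Longrightarrow> \<sigma> v \<subseteq> (adj ^^ D) `` {v}"
      "\<And>v. v \<in> leaf_verts L \<Longrightarrow> card (\<sigma> v) \<le> N"
      "\<And>v. v \<in> leaf_verts L \<Longrightarrow> \<exists>a. \<forall>u\<in>(adj ^^ (k * k + 2)) `` {v}. a \<in> \<sigma> u"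
    unfolding graph_cover_def by blast+
  define q where "q x = (SOME v. v \<in> leaf_verts L \<and> x \<in> snd v)" for x
  have q: "q x \<in> leaf_verts L" "x \<in> snd (q x)" if "x \<in> L" for x
    using someI_ex[OF leaf_vert_of_point[OF L that, unfolded Bex_def]] unfolding q_def by blast+
  have qv: "q x \<in> verts" if "x \<in> L" for x using q(1)[OF that] by (simp add: leaf_verts_def)
  define W where "W a = {x \<in> L. a \<in> \<sigma> (q x)}" for a
  define \<W> where "\<W> = range W"
  have Wx: "\<exists>a. \<forall>y\<in>L. leaf_dist x y \<le> real k \<longrightarrow> y \<in> W a" if x: "x \<in> L" for x
  proof -
    obtain a where a: "\<forall>u\<in>(adj ^^ (k * k + 2)) `` {q x}. a \<in> \<sigma> u"
      using \<sigma>(3)[OF q(1)[OF x]] by blast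
    have "y \<in> W a" if y: "y \<in> L" "leaf_dist x y \<le> real k" for y
    proof -
      have "(q x, q y) \<in> adj ^^ (k * k + 2)"
        using path_of_leaf_dist_le[OF L qv[OF x] q(2)[OF x] x qv[OF y(1)] q(2)[OF y(1)] y] .
      then show ?thesis using a y(1) unfolding W_def by blast
    qed
    then show ?thesis by blast
  qed
  have "open_cover L leaf_dist \<W>"
    unfolding open_cover_def
  proof
    show "\<forall>V\<in>\<W>. openin (Metric_space.mtopology L leaf_dist) V"
      using openin_leaf_dist[OF L] by (auto simp: \<W>_def W_def)
    show "\<Union>\<W> = L"
    proof
      show "L \<subseteq> \<Union>\<W>"
      proof
        fix x assume x: "x \<in> L"
        then obtain a where "x \<in> W a"
          using Wx[OF x] by (auto simp: plaque_dist_eq)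
        then show "x \<in> \<Union>\<W>" unfolding \<W>_def by blast
      qed
    qed (auto simp: \<W>_def W_def)
  qed
  \<comment> \<open>Two points with label \<open>a\<close> have vertices joined through
    \<open>a\<close> in \<open>D + D\<close> steps, and such a walk uses at most one plaque
    more.\<close>
  moreover have "leaf_dist x y \<le> real (Suc (D + D))" if xy: "x \<in> W a" "y \<in> W a" for a x y
  proof -
    have L': "x \<in> L" "y \<in> L" using xy by (auto simp: W_def)
    have "(q x, a) \<in> adj ^^ D" "(q y, a) \<in> adj ^^ D"
      using xy \<sigma>(1)[OF q(1)[OF L'(1)]] \<sigma>(1)[OF q(1)[OF L'(2)]] by (auto simp: W_def)
    then have "(q x, q y) \<in> adj ^^ (D + D)"
      using relpow_adj_sym relpow_trans by meson
    then show ?thesis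
      using leaf_dist_le_of_path qv[OF L'(1)] q(2)[OF L'(1)] q(2)[OF L'(2)] by blast
  qed
  then have "uniformly_bounded_family leaf_dist \<W>"
    unfolding uniformly_bounded_family_def \<W>_def by (intro exI[of _ "real (Suc (D + D))"]) auto
  moreover have "refines \<V> \<W>"
    unfolding refines_def
  proof
    fix V assume V: "V \<in> \<V>"
    show "\<exists>W\<in>\<W>. V \<subseteq> W"
    \<comment> \<open>An empty \<open>V\<close> offers no base point, but lies in any member of the
      range \<open>\<W>\<close>.\<close>
    proof (cases "V = {}")
      case True
      then show ?thesis by (auto simp: \<W>_def)
    next
      case False
      then obtain x where x: "x \<in> V" by blast
      then obtain a where a: "\<forall>y\<in>L. leaf_dist x y \<le> real k \<longrightarrow> y \<in> W a"
        using Wx VL[OF V] by blast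
      have "V \<subseteq> W a"
      proof
        fix y assume y: "y \<in> V"
        have "leaf_dist x y \<le> real k" using D0[OF V x y] k by simp
        then show "y \<in> W a" using a VL[OF V] y by blast
      qed
      then show ?thesis unfolding \<W>_def by blast
    qed
  qed
  moreover have "cover_multiplicity L \<W> \<le> enat N"
    unfolding cover_multiplicity_le_iff
  proof
    fix x assume x: "x \<in> L"
    have fin: "finite (\<sigma> (q x))"
      using \<sigma>(1)[OF q(1)[OF x]] finite_relpow_Image[OF adj_closed finite_adj qv[OF x]] finite_subset by blast
    have sub: "{V \<in> \<W>. x \<in> V} \<subseteq> W ` \<sigma> (q x)"
      by (auto simp: \<W>_def W_def)
    have "card {V \<in> \<W>. x \<in> V} \<le> card (\<sigma> (q x))"
      using sub fin surj_card_le by blast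
    then show "has_at_most {V \<in> \<W>. x \<in> V} (enat N)"
      using \<sigma>(2)[OF q(1)[OF x]] finite_subset[OF sub] fin by (simp add: has_at_most_def)
  qed
  ultimately show ?thesis by blast
qed

text \<open>For finite \<open>m\<close> the covering condition in \<open>asdim\<close> amounts to
  having, for every \<open>r\<close>, a graph cover with at most \<open>m + 1\<close> labels at each
  vertex and some bound \<open>D\<close>. For \<open>\<infinity>\<close> every cover refines itself.
  The two \<open>LEAST\<close> operators thus range over the same values.\<close>

lemma asdim_leaf_cong:
  assumes L: "L \<in> leaves X n \<F>" "L' \<in> leaves X n \<F>"
    and eq: "\<And>N r. (\<exists>D \<sigma>. graph_cover adj (leaf_verts L) N r D \<sigma>) \<longleftrightarrow>
                   (\<exists>D \<sigma>. graph_cover adj (leaf_verts L') N r D \<sigma>)"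
  shows "asdim L leaf_dist = asdim L' leaf_dist"
proof -
  let ?C = "\<lambda>L m. \<forall>\<V>. open_cover L leaf_dist \<V> \<and> uniformly_bounded_family leaf_dist \<V> \<longrightarrow>
        (\<exists>\<W>. open_cover L leaf_dist \<W> \<and> uniformly_bounded_family leaf_dist \<W> \<and> refines \<V> \<W> \<and>
             cover_multiplicity L \<W> \<le> m + 1)"
  have le: "?C L' m" if L: "L \<in> leaves X n \<F>" "L' \<in> leaves X n \<F>" and C: "?C L m"
    and eq: "\<And>N r. (\<exists>D \<sigma>. graph_cover adj (leaf_verts L) N r D \<sigma>) \<Longrightarrow>
                   (\<exists>D \<sigma>. graph_cover adj (leaf_verts L') N r D \<sigma>)" for L L' m
  proof (cases m)
    case (enat N)
    then have m: "m + 1 = enat (Suc N)" by (simp add: one_enat_def)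
    show ?thesis
      unfolding m
    proof (intro allI impI, elim conjE, rule leaf_cover_of_graph_cover[OF L(2)])
      fix r
      have "\<exists>D \<sigma>. graph_cover adj (leaf_verts L) (Suc N) r D \<sigma>"
        using C unfolding m by (intro graph_cover_of_leaf_cover[OF L(1)]) blast
      then show "\<exists>D \<sigma>. graph_cover adj (leaf_verts L') (Suc N) r D \<sigma>" by (rule eq)
    qed
  next
    case infinity
    then show ?thesis by (auto simp: refines_def)
  qed
  have "?C L m \<longleftrightarrow> ?C L' m" for m
    using le[OF L] le[OF L(2,1)] eq by blast
  then show ?thesis unfolding asdim_def by (intro arg_cong[where f = Least] ext)
qed

end

section \<open>Generic leaves\<close>

text \<open>\<open>T\<close> is the complement of the frontier of the open set \<open>S\<close>. It
  is dense because a point outside \<open>T\<close> is still in the closure of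
  \<open>S\<close>.\<close>

lemma openin_dense_complement_frontier:
  assumes "openin X S"
  defines "T \<equiv> S \<union> (topspace X - X closure_of S)"
  shows "openin X T" "X closure_of T = topspace X"
proof -
  show "openin X T"
    unfolding T_def using assms(1) by (intro openin_Un openin_diff) auto
  have "T \<subseteq> topspace X"
    unfolding T_def using openin_subset[OF assms(1)] by blast
  have "topspace X \<subseteq> X closure_of T"
  proof
    fix x assume x: "x \<in> topspace X"
    show "x \<in> X closure_of T"
    proof (cases "x \<in> X closure_of S")
      case True
      then show ?thesis unfolding T_def closure_of_Un by blast
    next
      case False
      then have "x \<in> T" using x by (simp add: T_def)
      then show ?thesis using closure_of_subset[OF \<open>T \<subseteq> topspace X\<close>] by blast
    qed
  qed
  then show "X closure_of T = topspace X"
    by (intro equalityI closure_of_subset_topspace)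
qed

section \<open>Chains of plaques prescribed by words of charts\<close>

text \<open>
  The points from which some chain of plaques of the charts in \<open>w\<close> leads to \<open>A\<close>.  The head of \<open>w\<close>
  is the last chart of the chain.
\<close>

primrec reach :: "('a, 'z) fol_chart list \<Rightarrow> 'a set \<Rightarrow> 'a set" where
  "reach [] A = A"
| "reach (c # w) A = reach w (sat c A)"

lemma sat_mono: "A \<subseteq> B \<Longrightarrow> sat c A \<subseteq> sat c B"
  unfolding sat_def by blast

lemma reach_mono: "A \<subseteq> B \<Longrightarrow> reach w A \<subseteq> reach w B"
  by (induction w arbitrary: A B) (simp_all add: sat_mono)

lemma reach_point: "x \<in> reach w A \<Longrightarrow> \<exists>y\<in>A. x \<in> reach w {y}"
proof (induction w arbitrary: A)
  case (Cons c w)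
  then obtain z where z: "z \<in> sat c A" "x \<in> reach w {z}" by auto
  then obtain y where y: "y \<in> A" "z \<in> sat c {y}" unfolding sat_def by blast
  have "x \<in> reach w (sat c {y})" using reach_mono[of "{z}" "sat c {y}" w] y(2) z(2) by blast
  then show ?case using y(1) by auto
qed simp

lemma reach_Cons_plaque:
  assumes "x \<in> reach w P" "P \<in> plaques c" "P \<inter> A \<noteq> {}"
  shows "x \<in> reach (c # w) A"
proof -
  have "P \<subseteq> sat c A" using assms(2,3) unfolding sat_def by blast
  then show ?thesis using reach_mono[of P _ w] assms(1) by auto
qed

lemma reach_Cons_cases:
  assumes "x \<in> reach (c # w) A"
  obtains P where "P \<in> plaques c" "P \<inter> A \<noteq> {}" "x \<in> reach w P"
proof -
  obtain y where y: "y \<in> sat c A" "x \<in> reach w {y}"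
    using reach_point[of x w "sat c A"] assms by auto
  then obtain P where P: "P \<in> plaques c" "P \<inter> A \<noteq> {}" "y \<in> P" unfolding sat_def by blast
  then show ?thesis using that reach_mono[of "{y}" P w] y(2) by blast
qed

context regular_foliated_space
begin

lemma openin_reach: "w \<in> lists \<U> \<Longrightarrow> openin X A \<Longrightarrow> openin X (reach w A)"
  by (induction w arbitrary: A) (auto simp: openin_sat[OF atlas_is_fol_chart])

text \<open>The shorter word determines the plaque over the preceding chart, and that plaque meets
  at most one plaque of \<open>c\<close>. A word therefore acts as a partial function of its
  starting point, as holonomy does.\<close>

lemma reach_unique:
  assumes "w \<in> lists \<U>" "c \<in> \<U>" "P \<in> plaques c" "P' \<in> plaques c" "x \<in> reach w P" "x \<in> reach w P'"
  shows "P = P'"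
  using assms
proof (induction w arbitrary: c P P')
  case Nil
  then show ?case using plaque_unique[of c c P P P'] by auto
next
  case (Cons d w)
  obtain Q where Q: "Q \<in> plaques d" "Q \<inter> P \<noteq> {}" "x \<in> reach w Q"
    using \<open>x \<in> reach (d # w) P\<close> by (rule reach_Cons_cases)
  obtain Q' where Q': "Q' \<in> plaques d" "Q' \<inter> P' \<noteq> {}" "x \<in> reach w Q'"
    using \<open>x \<in> reach (d # w) P'\<close> by (rule reach_Cons_cases)
  have "Q = Q'" by (rule Cons.IH[OF Cons.hyps(1) Q(1) Q'(1) Q(3) Q'(3)])
  then show ?case using plaque_unique[of d c Q P P'] Q Q' Cons.prems Cons.hyps(1) by auto
qed

text \<open>Since \<open>chart_dom c\<close> is open, the possibility of following \<open>w\<close>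
  to some plaque of \<open>c\<close> becomes membership in a single open set.\<close>

lemma reach_chart_dom_iff:
  assumes "c \<in> \<U>"
  shows "x \<in> reach w (chart_dom c) \<longleftrightarrow> (\<exists>P\<in>plaques c. x \<in> reach w P)"
proof
  assume "x \<in> reach w (chart_dom c)"
  then obtain y where y: "y \<in> chart_dom c" "x \<in> reach w {y}" using reach_point[of x w "chart_dom c"] by blast
  then obtain P where "P \<in> plaques c" "y \<in> P"
    using plaque_of_point[OF atlas_is_fol_chart[OF assms]] by blast
  then show "\<exists>P\<in>plaques c. x \<in> reach w P"
    using reach_mono[of "{y}" P w] y(2) by blast
next
  assume "\<exists>P\<in>plaques c. x \<in> reach w P"
  then show "x \<in> reach w (chart_dom c)"
    using reach_mono plaque_subset_dom[OF atlas_is_fol_chart[OF assms]] by blast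
qed

text \<open>Whether two words end in the same plaque need not be an open condition on the starting
  point, whereas ending in different plaques of one chart is; so separation is what gets
  recorded.\<close>

definition diverge :: "('a, 'z) fol_chart \<Rightarrow> ('a, 'z) fol_chart list \<Rightarrow> ('a, 'z) fol_chart list \<Rightarrow> 'a set" where
  "diverge c w w' = {x. \<exists>P\<in>plaques c. \<exists>P'\<in>plaques c. P \<noteq> P' \<and> x \<in> reach w P \<and> x \<in> reach w' P'}"

text \<open>Different plaques of \<open>c\<close> have different transverse coordinates, which the
  Hausdorff transversal separates by disjoint open sets. Nearby points have chains into the two
  corresponding slabs, and these share no plaque.\<close>

lemma openin_diverge:
  assumes c: "c \<in> \<U>" and w: "w \<in> lists \<U>" "w' \<in> lists \<U>"
  shows "openin X (diverge c w w')"
proof (subst openin_subopen, intro ballI)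
  note chart = atlas_is_fol_chart[OF c]
  fix x assume "x \<in> diverge c w w'"
  then obtain P P' where P: "P \<in> plaques c" "P' \<in> plaques c" "P \<noteq> P'" "x \<in> reach w P" "x \<in> reach w' P'"
    by (auto simp: diverge_def)
  obtain y y' where y: "y \<in> P" "y' \<in> P'" using plaque_nonempty[OF chart] P(1,2) by blast
  have yd: "y \<in> chart_dom c" "y' \<in> chart_dom c" using y P plaque_subset_dom[OF chart] by blast+
  have "tcoord c y \<noteq> tcoord c y'"
    using P(3) plaque_eqI[OF chart P(1) y(1)] plaque_eqI[OF chart P(2) y(2)] by auto
  then obtain T T' where T: "openin (chart_trans c) T" "openin (chart_trans c) T'"
      "tcoord c y \<in> T" "tcoord c y' \<in> T'" "T \<inter> T' = {}"
    using Hausdorff_chart_trans[OF chart] chart_map_mem(2)[OF chart] yd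
    unfolding Hausdorff_space_def disjnt_def by metis
  define A where "A = {x \<in> chart_dom c. tcoord c x \<in> T}"
  define A' where "A' = {x \<in> chart_dom c. tcoord c x \<in> T'}"
  have "openin X (reach w A \<inter> reach w' A')"
    using openin_tcoord_preimage[OF chart] T(1,2) w unfolding A_def A'_def
    by (intro openin_Int openin_reach) auto
  moreover have "x \<in> reach w A \<inter> reach w' A'"
  proof -
    have "P \<subseteq> A" "P' \<subseteq> A'"
      using plaque_eqI[OF chart P(1) y(1)] plaque_eqI[OF chart P(2) y(2)] T(3,4)
      by (auto simp: A_def A'_def)
    then show ?thesis using P(4,5) reach_mono by blast
  qed
  moreover have "reach w A \<inter> reach w' A' \<subseteq> diverge c w w'"
  proof
    fix z assume "z \<in> reach w A \<inter> reach w' A'"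
    then obtain a a' where a: "a \<in> A" "z \<in> reach w {a}" "a' \<in> A'" "z \<in> reach w' {a'}"
      using reach_point by (metis IntE)
    have ad: "a \<in> chart_dom c" "a' \<in> chart_dom c" using a by (simp_all add: A_def A'_def)
    obtain Q Q' where Q: "Q \<in> plaques c" "a \<in> Q" "Q' \<in> plaques c" "a' \<in> Q'"
      using plaque_of_point[OF chart ad(1)] plaque_of_point[OF chart ad(2)] by blast
    have "Q \<noteq> Q'"
    proof
      assume "Q = Q'"
      then have "tcoord c a' = tcoord c a" using plaque_eqI[OF chart Q(1,2)] Q(4) by blast
      then show False using a(1,3) T(5) by (auto simp: A_def A'_def)
    qed
    moreover have "z \<in> reach w Q" "z \<in> reach w' Q'"
      using a Q reach_mono[of "{a}" Q w] reach_mono[of "{a'}" Q' w'] by blast+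
    ultimately show "z \<in> diverge c w w'" using Q by (auto simp: diverge_def)
  qed
  ultimately show "\<exists>T. openin X T \<and> x \<in> T \<and> T \<subseteq> diverge c w w'" by blast
qed

lemma charts_subset: "charts \<subseteq> \<U>"
  by (auto simp: charts_def)

lemma lists_charts: "w \<in> lists charts \<Longrightarrow> w \<in> lists \<U>"
  using charts_subset by auto

lemma reach_leaf:
  assumes L: "L \<in> leaves X n \<F>" and "w \<in> lists \<U>" "x \<in> L" "x \<in> reach w A"
  shows "L \<inter> A \<noteq> {}"
  using assms(2-)
proof (induction w arbitrary: A)
  case (Cons c w)
  obtain P where P: "P \<in> plaques c" "P \<inter> A \<noteq> {}" "x \<in> reach w P"
    using \<open>x \<in> reach (c # w) A\<close> by (rule reach_Cons_cases)
  have "L \<inter> P \<noteq> {}" using Cons P(3) by auto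
  moreover have "(c, P) \<in> verts" using P(1) Cons.hyps(1) by (simp add: verts_def)
  ultimately have "P \<subseteq> L" using leaf_vertsI[OF L, of "(c, P)"] by (auto simp: leaf_verts_def)
  then show ?case using P(2) by blast
qed auto

text \<open>Connectedness of the leaf gives a walk from a plaque through \<open>x\<close> to
  \<open>v\<close>. The charts of the vertices before \<open>v\<close>, read from the far end, form
  the word.\<close>

lemma leaf_reach:
  assumes L: "L \<in> leaves X n \<F>" and x: "x \<in> L" and v: "v \<in> leaf_verts L"
  shows "\<exists>w\<in>lists charts. x \<in> reach w (snd v)"
proof -
  obtain v0 where v0: "v0 \<in> leaf_verts L" "x \<in> snd v0" using leaf_vert_of_point[OF L x] by blast
  obtain k where "(v0, v) \<in> adj ^^ k" using leaf_path[OF L v0(1) v] by blast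
  then show ?thesis
  proof (induction k arbitrary: v)
    case 0
    then show ?case using v0 by (intro bexI[of _ "[]"]) auto
  next
    case (Suc k)
    from Suc.prems obtain u where u: "(v0, u) \<in> adj ^^ k" "(u, v) \<in> adj" by (rule relpow_Suc_E)
    obtain w where w: "w \<in> lists charts" "x \<in> reach w (snd u)" using Suc.IH[OF u(1)] by blast
    have "u \<in> verts" "snd u \<inter> snd v \<noteq> {}" using u(2) by (auto simp: adj_def)
    then have "x \<in> reach (fst u # w) (snd v)"
      using reach_Cons_plaque[OF w(2)] vert_plaque by blast
    then show ?case
      using w(1) vert_chart[OF \<open>u \<in> verts\<close>] by (intro bexI[of _ "fst u # w"]) auto
  qed
qed

section \<open>Marks of bounded length and the ball isomorphisms that they determine\<close>

definition words :: "nat \<Rightarrow> ('a, 'z) fol_chart list set" where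
  "words m = {w. set w \<subseteq> charts \<and> length w \<le> m}"

lemma words_lists: "w \<in> words m \<Longrightarrow> w \<in> lists charts"
  by (auto simp: words_def)

definition marks :: "('a, 'z) fol_chart list set \<Rightarrow> 'a set set" where
  "marks W = (\<lambda>(c, w). reach w (chart_dom c)) ` (charts \<times> W) \<union>
     (\<lambda>(c, w, w'). diverge c w w') ` (charts \<times> W \<times> W)"

lemma marks_mono: "W \<subseteq> W' \<Longrightarrow> marks W \<subseteq> marks W'"
  unfolding marks_def by (intro Un_mono image_mono Sigma_mono) auto

lemma openin_marks:
  assumes "W \<subseteq> lists charts" "S \<in> marks W"
  shows "openin X S"
proof -
  have W: "w \<in> lists \<U>" if "w \<in> W" for w
    using that assms(1) lists_charts by blast
  consider c w where "S = reach w (chart_dom c)" "c \<in> charts" "w \<in> W"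
    | c w w' where "S = diverge c w w'" "c \<in> charts" "w \<in> W" "w' \<in> W"
    using assms(2) unfolding marks_def by auto
  then show ?thesis
  proof cases
    case 1
    then show ?thesis
      using openin_reach[OF W chart_dom_open[OF atlas_is_fol_chart]] charts_subset by blast
  next
    case 2
    then show ?thesis
      using openin_diverge[OF _ W W] charts_subset by blast
  qed
qed

definition same_marks :: "nat \<Rightarrow> 'a \<Rightarrow> 'a \<Rightarrow> bool" where
  "same_marks m x x' \<longleftrightarrow> (\<forall>S\<in>marks (words m). x \<in> S \<longleftrightarrow> x' \<in> S)"

lemma same_marks_sym: "same_marks m x x' \<Longrightarrow> same_marks m x' x"
  by (auto simp: same_marks_def)

lemma same_marks_mono: "same_marks m x x' \<Longrightarrow> k \<le> m \<Longrightarrow> same_marks k x x'"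
proof -
  assume "k \<le> m"
  then have "words k \<subseteq> words m" by (auto simp: words_def)
  then have "marks (words k) \<subseteq> marks (words m)" by (rule marks_mono)
  then show "same_marks m x x' \<Longrightarrow> same_marks k x x'" unfolding same_marks_def by blast
qed

lemma same_marks_reach:
  assumes "same_marks m x x'" "c \<in> charts" "w \<in> words m"
  shows "x \<in> reach w (chart_dom c) \<longleftrightarrow> x' \<in> reach w (chart_dom c)"
proof -
  have "reach w (chart_dom c) \<in> marks (words m)"
    unfolding marks_def by (rule UnI1, rule image_eqI[of _ _ "(c, w)"]) (use assms(2,3) in auto)
  then show ?thesis using assms(1) unfolding same_marks_def by blast
qed

lemma same_marks_diverge:
  assumes "same_marks m x x'" "c \<in> charts" "w \<in> words m" "w' \<in> words m"
  shows "x \<in> diverge c w w' \<longleftrightarrow> x' \<in> diverge c w w'"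
proof -
  have "diverge c w w' \<in> marks (words m)"
    unfolding marks_def by (rule UnI2, rule image_eqI[of _ _ "(c, w, w')"]) (use assms(2-) in auto)
  then show ?thesis using assms(1) unfolding same_marks_def by blast
qed

text \<open>Vertices are matched when one word leads to both from the two base points. The chart of
  the vertex itself is not counted in the word, so level 0 relates plaques through \<open>x\<close>
  to plaques through \<open>x'\<close>.\<close>

definition iso_rel :: "'a \<Rightarrow> 'a \<Rightarrow> nat \<Rightarrow> ((('a, 'z) fol_chart \<times> 'a set) \<times> ('a, 'z) fol_chart \<times> 'a set) set" where
  "iso_rel x x' m = {(v, v'). v \<in> verts \<and> v' \<in> verts \<and> fst v = fst v' \<and>
     (\<exists>w\<in>words m. x \<in> reach w (snd v) \<and> x' \<in> reach w (snd v'))}"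

lemma iso_rel_converse: "(iso_rel x x' m)\<inverse> = iso_rel x' x m"
  by (auto simp: iso_rel_def)

text \<open>Two words leading from \<open>x\<close> to the same vertex do not diverge at
  \<open>x\<close>, hence not at \<open>x'\<close> either, so the partner of a vertex does not
  depend on the word.\<close>

lemma single_valued_iso_rel:
  assumes "same_marks m x x'"
  shows "single_valued (iso_rel x x' m)"
proof (rule single_valuedI)
  fix v v1 v2 assume v: "(v, v1) \<in> iso_rel x x' m" "(v, v2) \<in> iso_rel x x' m"
  obtain w1 where w1: "w1 \<in> words m" "x \<in> reach w1 (snd v)" "x' \<in> reach w1 (snd v1)"
    using v(1) by (auto simp: iso_rel_def)
  obtain w2 where w2: "w2 \<in> words m" "x \<in> reach w2 (snd v)" "x' \<in> reach w2 (snd v2)"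
    using v(2) by (auto simp: iso_rel_def)
  have verts: "v \<in> verts" "v1 \<in> verts" "v2 \<in> verts" "fst v1 = fst v" "fst v2 = fst v"
    using v by (auto simp: iso_rel_def)
  have U: "fst v \<in> \<U>" "snd v \<in> plaques (fst v)" "snd v1 \<in> plaques (fst v)" "snd v2 \<in> plaques (fst v)"
    using vert_plaque[OF verts(1)] vert_plaque[OF verts(2)] vert_plaque[OF verts(3)] verts(4,5) by simp_all
  have lists: "w1 \<in> lists \<U>" "w2 \<in> lists \<U>"
    using w1(1) w2(1) words_lists lists_charts by blast+
  have "x \<notin> diverge (fst v) w1 w2"
    using reach_unique[OF lists(1) U(1) _ U(2) _ w1(2)] reach_unique[OF lists(2) U(1) _ U(2) _ w2(2)]
    unfolding diverge_def by blast
  then have "x' \<notin> diverge (fst v) w1 w2"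
    using same_marks_diverge[OF assms vert_chart[OF verts(1)] w1(1) w2(1)] by blast
  then have "snd v1 = snd v2"
    using U w1(3) w2(3) unfolding diverge_def by blast
  then show "v1 = v2" using verts by (simp add: prod_eq_iff)
qed

text \<open>With the chart of \<open>v\<close> added, the word leads from \<open>x\<close> to
  \<open>u\<close>. As the marks agree, it leads from \<open>x'\<close> to some plaque over the
  chart of \<open>u\<close>, and the last but one plaque of that chain is that of \<open>v'\<close>
  by \<open>reach_unique\<close>.\<close>

lemma iso_rel_forth:
  assumes marks: "same_marks (Suc m) x x'" and v: "(v, v') \<in> iso_rel x x' m" and vu: "(v, u) \<in> adj"
  shows "\<exists>u'. (v', u') \<in> adj \<and> (u, u') \<in> iso_rel x x' (Suc m)"
proof -
  obtain w where w: "w \<in> words m" "x \<in> reach w (snd v)" "x' \<in> reach w (snd v')"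
    using v by (auto simp: iso_rel_def)
  have verts: "v \<in> verts" "v' \<in> verts" "fst v' = fst v" "u \<in> verts" "snd v \<inter> snd u \<noteq> {}"
    using v vu by (auto simp: iso_rel_def adj_def)
  note pl = vert_plaque[OF verts(1)] vert_plaque[OF verts(2)] vert_plaque[OF verts(4)]
  let ?w = "fst v # w"
  have W: "?w \<in> words (Suc m)"
    using w(1) vert_chart[OF verts(1)] by (auto simp: words_def)
  have xu: "x \<in> reach ?w (snd u)"
    using reach_Cons_plaque[OF w(2)] pl verts(5) by blast
  then have "x \<in> reach ?w (chart_dom (fst u))"
    using reach_chart_dom_iff pl by blast
  then have "x' \<in> reach ?w (chart_dom (fst u))"
    using same_marks_reach[OF marks vert_chart[OF verts(4)] W] by blast
  then obtain Q where Q: "Q \<in> plaques (fst u)" "x' \<in> reach ?w Q"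
    using reach_chart_dom_iff pl by blast
  obtain P where P: "P \<in> plaques (fst v)" "P \<inter> Q \<noteq> {}" "x' \<in> reach w P"
    using Q(2) by (rule reach_Cons_cases)
  have "P = snd v'"
    using reach_unique[OF lists_charts[OF words_lists[OF w(1)]], of "fst v" P "snd v'" x'] P pl w(3) verts(3) by auto
  moreover have uQ: "(fst u, Q) \<in> verts" using Q(1) pl by (simp add: verts_def)
  ultimately have "(v', (fst u, Q)) \<in> adj"
    using P(2) verts(2) by (simp add: adj_def)
  moreover have "(u, (fst u, Q)) \<in> iso_rel x x' (Suc m)"
    using uQ verts(4) xu Q(2) W unfolding iso_rel_def
    by (auto simp del: reach.simps intro!: bexI[of _ ?w])
  ultimately show ?thesis by blast
qed

lemma iso_rel_back:
  assumes marks: "same_marks (Suc m) x x'" and v: "(v, v') \<in> iso_rel x x' m" and vu: "(v', u') \<in> adj"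
  shows "\<exists>u. (v, u) \<in> adj \<and> (u, u') \<in> iso_rel x x' (Suc m)"
  using iso_rel_forth[OF same_marks_sym[OF marks], of v' v u'] v vu
  by (simp flip: iso_rel_converse[of x x'])

text \<open>The shift \<open>K\<close> allows centres that are themselves reached only by words of
  length up to \<open>K\<close>; each further edge costs one chart.\<close>

lemma ball_iso_iso_rel:
  assumes "same_marks (K + M) x x'"
  shows "ball_iso adj M (\<lambda>k. iso_rel x x' (K + k))"
  unfolding ball_iso_def
proof (intro conjI allI impI)
  have "iso_rel x x' i \<subseteq> iso_rel x x' j" if "i \<le> j" for i j
    using that unfolding iso_rel_def words_def by (auto intro: order_trans)
  then show "mono (\<lambda>k. iso_rel x x' (K + k))"
    by (intro monoI) simp
  show "single_valued (iso_rel x x' (K + M))" by (rule single_valued_iso_rel[OF assms])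
  show "single_valued ((iso_rel x x' (K + M))\<inverse>)"
    unfolding iso_rel_converse by (rule single_valued_iso_rel[OF same_marks_sym[OF assms]])
next
  fix k v v' u assume k: "k < M" and v: "(v, v') \<in> iso_rel x x' (K + k)"
  have marks: "same_marks (Suc (K + k)) x x'" using same_marks_mono[OF assms] k by simp
  show "\<exists>u'. (v', u') \<in> adj \<and> (u, u') \<in> iso_rel x x' (K + Suc k)" if "(v, u) \<in> adj"
    using iso_rel_forth[OF marks v that] by simp
  show "\<exists>w. (v, w) \<in> adj \<and> (w, u) \<in> iso_rel x x' (K + Suc k)" if "(v', u) \<in> adj"
    using iso_rel_back[OF marks v that] by simp
qed

section \<open>Generic points and their leaves\<close>

definition generic :: "'a \<Rightarrow> bool" where
  "generic x \<longleftrightarrow> x \<in> topspace X \<and>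
     (\<forall>S\<in>marks (lists charts). x \<in> S \<union> (topspace X - X closure_of S)) \<and>
     (\<forall>L\<in>leaves X n \<F>. x \<in> L \<longrightarrow> X closure_of L = topspace X)"

text \<open>Words of bounded length give finitely many marks. Each of them contains a neighbourhood
  of \<open>x\<close> or misses one, because \<open>x\<close> is not on its frontier.\<close>

lemma generic_same_marks:
  assumes "generic x"
  shows "\<exists>N. openin X N \<and> x \<in> N \<and> (\<forall>y\<in>N. same_marks m x y)"
proof -
  define N where "N S = (if x \<in> S then S else topspace X - X closure_of S)" for S
  have sub: "words m \<subseteq> lists charts" by (auto simp: words_def)
  then have sub': "marks (words m) \<subseteq> marks (lists charts)" by (rule marks_mono)
  have fin: "finite (marks (words m))"
    using finite_lists_length_le[OF finite_charts, of m] finite_charts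
    unfolding marks_def words_def by blast
  have x: "x \<in> topspace X" "\<And>S. S \<in> marks (words m) \<Longrightarrow> x \<in> N S"
    using assms sub' unfolding generic_def N_def by auto
  have open_N: "openin X (N S)" if "S \<in> marks (words m)" for S
    using openin_marks[OF sub that] by (auto simp: N_def)
  have "openin X (\<Inter>(insert (topspace X) (N ` marks (words m))))"
    using fin open_N by (intro openin_Inter) auto
  moreover have "same_marks m x y" if y: "y \<in> \<Inter>(insert (topspace X) (N ` marks (words m)))" for y
    unfolding same_marks_def
  proof
    fix S assume S: "S \<in> marks (words m)"
    then have yN: "y \<in> N S" using y by blast
    have "S \<subseteq> X closure_of S"
      using openin_marks[OF sub S] openin_subset closure_of_subset by metis
    then show "x \<in> S \<longleftrightarrow> y \<in> S" using yN by (auto simp: N_def split: if_splits)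
  qed
  ultimately show ?thesis using x by blast
qed

text \<open>Only \<open>x\<close> is generic here: the dense leaf \<open>L'\<close> enters the
  neighbourhood on which the marks agree with those at \<open>x\<close>, and any point
  \<open>x'\<close> found there will do.\<close>

lemma graph_cover_generic_leaf:
  assumes L: "L \<in> leaves X n \<F>" "L' \<in> leaves X n \<F>" and x: "generic x" "x \<in> L"
    and dense: "X closure_of L' = topspace X"
    and cover: "graph_cover adj (leaf_verts L') N r D \<sigma>'"
  shows "\<exists>\<sigma>. graph_cover adj (leaf_verts L) N r D \<sigma>"
proof (rule graph_cover_transfer[OF adj_leaf_verts[OF L(1)] adj_leaf_verts[OF L(2)] _ finite_adj sym_adj _ cover])
  show "(v, v) \<in> adj" if "v \<in> leaf_verts L \<union> leaf_verts L'" for v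
    using that adj_refl[of v] by (auto simp: leaf_verts_def)
next
  fix F M assume F: "finite F" "F \<subseteq> leaf_verts L"
  have "\<forall>v\<in>F. \<exists>w\<in>lists charts. x \<in> reach w (snd v)"
    using leaf_reach[OF L(1) x(2)] F(2) by blast
  then obtain wd where wd: "\<And>v. v \<in> F \<Longrightarrow> wd v \<in> lists charts" "\<And>v. v \<in> F \<Longrightarrow> x \<in> reach (wd v) (snd v)"
    by metis
  \<comment> \<open>\<open>K\<close> bounds the words used to reach \<open>F\<close>, with 0 for
    empty \<open>F\<close>; following \<open>M\<close> more edges then involves words of length up
    to \<open>K + M\<close>.\<close>
  define K where "K = Max (insert 0 ((\<lambda>v. length (wd v)) ` F))"
  have wdK: "wd v \<in> words K" if "v \<in> F" for v
    using wd(1)[OF that] F(1) that by (auto simp: words_def K_def)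
  obtain N where N: "openin X N" "x \<in> N" "\<And>y. y \<in> N \<Longrightarrow> same_marks (K + M) x y"
    using generic_same_marks[OF x(1), of "K + M"] by meson
  have "x \<in> X closure_of L'" using dense x(1) by (simp add: generic_def)
  then obtain x' where x': "x' \<in> L'" "x' \<in> N" using N(1,2) unfolding in_closure_of by blast
  note marks = N(3)[OF x'(2)]
  have "iso_rel x x' m \<subseteq> leaf_verts L \<times> leaf_verts L'" for m
  proof
    fix p assume "p \<in> iso_rel x x' m"
    then obtain v v' w where p: "p = (v, v')" "v \<in> verts" "v' \<in> verts" "w \<in> words m"
        "x \<in> reach w (snd v)" "x' \<in> reach w (snd v')"
      by (auto simp: iso_rel_def)
    have w: "w \<in> lists \<U>" using lists_charts words_lists p(4) by blast
    have "v \<in> leaf_verts L"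
      using leaf_vertsI[OF L(1) p(2)] reach_leaf[OF L(1) w x(2) p(5)] by blast
    moreover have "v' \<in> leaf_verts L'"
      using leaf_vertsI[OF L(2) p(3)] reach_leaf[OF L(2) w x'(1) p(6)] by blast
    ultimately show "p \<in> leaf_verts L \<times> leaf_verts L'" using p(1) by blast
  qed
  moreover have "\<exists>v'. (v, v') \<in> iso_rel x x' K" if v: "v \<in> F" for v
  proof -
    have vv: "v \<in> verts" using F(2) v by (auto simp: leaf_verts_def)
    note pl = vert_plaque[OF vv]
    have "x \<in> reach (wd v) (chart_dom (fst v))"
      using reach_chart_dom_iff pl wd(2)[OF v] by blast
    then have "x' \<in> reach (wd v) (chart_dom (fst v))"
      using same_marks_reach[OF same_marks_mono[OF marks] vert_chart[OF vv] wdK[OF v]] by simp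
    then obtain P where P: "P \<in> plaques (fst v)" "x' \<in> reach (wd v) P"
      using reach_chart_dom_iff pl by blast
    then have "(v, (fst v, P)) \<in> iso_rel x x' K"
      using wd(2)[OF v] wdK[OF v] vv pl unfolding iso_rel_def by (auto simp: verts_def)
    then show ?thesis by blast
  qed
  ultimately show "\<exists>\<Psi>. ball_iso adj M \<Psi> \<and> \<Psi> M \<subseteq> leaf_verts L \<times> leaf_verts L' \<and> (\<forall>v\<in>F. \<exists>v'. (v, v') \<in> \<Psi> 0)"
    using ball_iso_iso_rel[OF marks] by (intro exI[of _ "\<lambda>k. iso_rel x x' (K + k)"]) auto
qed

lemma asdim_generic_leaves:
  assumes "L \<in> leaves X n \<F>" "L' \<in> leaves X n \<F>" "generic x" "x \<in> L" "generic x'" "x' \<in> L'"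
  shows "asdim L leaf_dist = asdim L' leaf_dist"
proof (rule asdim_leaf_cong[OF assms(1,2)])
  have "X closure_of L = topspace X" "X closure_of L' = topspace X"
    using assms unfolding generic_def by blast+
  then show "(\<exists>D \<sigma>. graph_cover adj (leaf_verts L) N r D \<sigma>) \<longleftrightarrow>
      (\<exists>D \<sigma>. graph_cover adj (leaf_verts L') N r D \<sigma>)" for N r
    using graph_cover_generic_leaf[OF assms(1,2,3,4)] graph_cover_generic_leaf[OF assms(2,1,5,6)] by blast
qed

text \<open>The union is made of the leaves that meet \<open>B\<close>. The dense leaf is among
  them, since a dense set meets every nonempty open set.\<close>

lemma dense_reachable_set:
  assumes trans: "transitive_foliation X n \<F>" and B: "openin X B" "B \<noteq> {}"
  shows "openin X (\<Union>w\<in>lists charts. reach w B)"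
    and "X closure_of (\<Union>w\<in>lists charts. reach w B) = topspace X"
proof -
  let ?S = "\<Union>w\<in>lists charts. reach w B"
  show open_S: "openin X ?S"
    using openin_reach[OF lists_charts B(1)] by blast
  obtain L where L: "L \<in> leaves X n \<F>" "X closure_of L = topspace X"
    using trans by (auto simp: transitive_foliation_def)
  obtain b where "b \<in> B" using B(2) by blast
  then have "b \<in> X closure_of L" using L(2) openin_subset[OF B(1)] by blast
  then obtain y where y: "y \<in> L" "y \<in> B" using B(1) \<open>b \<in> B\<close> unfolding in_closure_of by blast
  obtain v where v: "v \<in> leaf_verts L" "y \<in> snd v" using leaf_vert_of_point[OF L(1) y(1)] by blast
  then have vv: "v \<in> verts" by (simp add: leaf_verts_def)
  have "L \<subseteq> ?S"
  proof
    fix z assume "z \<in> L"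
    then obtain w where w: "w \<in> lists charts" "z \<in> reach w (snd v)" using leaf_reach[OF L(1) _ v(1)] by blast
    have "z \<in> reach (fst v # w) B"
      using reach_Cons_plaque[OF w(2)] vert_plaque[OF vv] v(2) y(2) by blast
    moreover have "fst v # w \<in> lists charts" using w(1) vert_chart[OF vv] by simp
    ultimately show "z \<in> ?S" by blast
  qed
  then have "topspace X \<subseteq> X closure_of ?S"
    using closure_of_mono[of L ?S X] L(2) by simp
  then show "X closure_of ?S = topspace X"
    using closure_of_subset_topspace[of X ?S] by blast
qed

lemma residual_generic:
  assumes trans: "transitive_foliation X n \<F>"
  shows "\<exists>\<G>. countable \<G> \<and> (\<forall>G \<in> \<G>. openin X G \<and> X closure_of G = topspace X) \<and>
          topspace X \<inter> \<Inter>\<G> \<subseteq> {x. generic x}"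
proof -
  obtain \<B> where \<B>: "countable \<B>" "\<And>V. V \<in> \<B> \<Longrightarrow> openin X V"
      "\<And>S x. openin X S \<Longrightarrow> x \<in> S \<Longrightarrow> \<exists>V\<in>\<B>. x \<in> V \<and> V \<subseteq> S"
    using foliated unfolding compact_Polish_foliated_space_def second_countable_def by metis
  \<comment> \<open>\<open>\<G>1\<close> keeps points off the frontiers of all marks, and
    \<open>\<G>2\<close> makes their leaf meet every nonempty member of the base. Both are countable
    because the alphabet of charts is finite and the base is countable.\<close>
  define \<G>1 where "\<G>1 = (\<lambda>S. S \<union> (topspace X - X closure_of S)) ` marks (lists charts)"
  define \<G>2 where "\<G>2 = (\<lambda>B. \<Union>w\<in>lists charts. reach w B) ` (\<B> - {{}})"
  have "countable (lists charts)"
    using finite_charts by (simp add: countable_finite)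
  then have "countable (\<G>1 \<union> \<G>2)"
    using \<B>(1) countable_finite[OF finite_charts] unfolding \<G>1_def \<G>2_def marks_def
    by (intro countable_Un countable_image countable_SIGMA countable_Diff) auto
  moreover have "\<forall>G\<in>\<G>1 \<union> \<G>2. openin X G \<and> X closure_of G = topspace X"
  proof
    fix G assume "G \<in> \<G>1 \<union> \<G>2"
    then show "openin X G \<and> X closure_of G = topspace X"
    proof
      assume "G \<in> \<G>1"
      then obtain S where "S \<in> marks (lists charts)" "G = S \<union> (topspace X - X closure_of S)"
        by (auto simp: \<G>1_def)
      then show ?thesis using openin_dense_complement_frontier[OF openin_marks[OF order_refl]] by blast
    next
      assume "G \<in> \<G>2"
      then obtain B where "B \<in> \<B>" "B \<noteq> {}" "G = (\<Union>w\<in>lists charts. reach w B)"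
        by (auto simp: \<G>2_def)
      then show ?thesis using dense_reachable_set[OF trans \<B>(2)] by blast
    qed
  qed
  moreover have "generic x" if x: "x \<in> topspace X \<inter> \<Inter>(\<G>1 \<union> \<G>2)" for x
    unfolding generic_def
  proof (intro conjI ballI impI)
    show "x \<in> topspace X" using x by blast
    show "x \<in> S \<union> (topspace X - X closure_of S)" if "S \<in> marks (lists charts)" for S
    proof -
      have "S \<union> (topspace X - X closure_of S) \<in> \<G>1"
        unfolding \<G>1_def using that by (rule imageI)
      then show ?thesis using x by blast
    qed
    fix L assume L: "L \<in> leaves X n \<F>" "x \<in> L"
    have "topspace X \<subseteq> X closure_of L"
    proof
      fix y assume y: "y \<in> topspace X"
      have "\<exists>z. z \<in> L \<and> z \<in> T" if T: "y \<in> T" "openin X T" for T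
      proof -
        obtain V where V: "V \<in> \<B>" "y \<in> V" "V \<subseteq> T" using \<B>(3)[OF T(2,1)] by blast
        then have "(\<Union>w\<in>lists charts. reach w V) \<in> \<G>2"
          unfolding \<G>2_def by (intro imageI) blast
        then obtain w where "w \<in> lists charts" "x \<in> reach w V" using x by blast
        then have "L \<inter> V \<noteq> {}" using reach_leaf[OF L(1) lists_charts L(2)] by blast
        then show ?thesis using V(3) by blast
      qed
      then show "y \<in> X closure_of L" using y unfolding in_closure_of by blast
    qed
    then show "X closure_of L = topspace X"
      using closure_of_subset_topspace[of X L] by blast
  qed
  ultimately show ?thesis by (intro exI[of _ "\<G>1 \<union> \<G>2"]) blast
qed

end

theorem theorem1p12:
  fixes X :: "'a topology" and n :: nat and \<F> \<U> :: "('a, 'z) fol_chart set"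
  assumes "compact_Polish_foliated_space X n \<F>"
    and "transitive_foliation X n \<F>"
    and "regular_fol_atlas X n \<F> \<U>"
  shows "\<exists>Y (k::enat). residual_set X Y \<and> saturated_set X n \<F> Y \<and>
           (\<forall>L \<in> leaves X n \<F>. L \<subseteq> Y \<longrightarrow> asdim L (plaque_dist X n \<F> \<U>) = k)"
proof -
  interpret regular_foliated_space X n \<F> \<U>
    using assms(1,3) by (rule regular_foliated_space.intro)
  define \<L> where "\<L> = {L \<in> leaves X n \<F>. \<exists>x\<in>L. generic x}"
  have sat: "saturated_set X n \<F> (\<Union>\<L>)"
    unfolding saturated_set_def by (rule exI[of _ \<L>]) (simp add: \<L>_def)
  obtain \<G> where \<G>: "countable \<G>" "\<forall>G \<in> \<G>. openin X G \<and> X closure_of G = topspace X"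
      "topspace X \<inter> \<Inter>\<G> \<subseteq> {x. generic x}"
    using residual_generic[OF assms(2)] by blast
  have "x \<in> \<Union>\<L>" if "generic x" for x
  proof -
    have "x \<in> \<Union>(leaves X n \<F>)" using that Union_leaves by (simp add: generic_def)
    then show ?thesis using that by (auto simp: \<L>_def)
  qed
  then have "topspace X \<inter> \<Inter>\<G> \<subseteq> \<Union>\<L>" using \<G>(3) by blast
  moreover have "\<Union>\<L> \<subseteq> topspace X" using leaf_subset by (auto simp: \<L>_def)
  ultimately have res: "residual_set X (\<Union>\<L>)"
    using \<G>(1,2) unfolding residual_set_def by blast
  \<comment> \<open>Leaves are disjoint, so a leaf inside the union is one of those that form
    it.\<close>
  have mem: "L \<in> \<L>" if L: "L \<in> leaves X n \<F>" "L \<subseteq> \<Union>\<L>" for L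
  proof -
    obtain x where "x \<in> L" using leaf_nonempty[OF L(1)] by blast
    then obtain L' where "L' \<in> \<L>" "x \<in> L'" using L(2) by blast
    then have "L = L'" using leaves_disjoint[OF L(1)] \<open>x \<in> L\<close> by (auto simp: \<L>_def)
    then show ?thesis using \<open>L' \<in> \<L>\<close> by simp
  qed
  have "\<exists>k. \<forall>L\<in>\<L>. asdim L leaf_dist = k"
  \<comment> \<open>If \<open>\<L>\<close> is empty, any value of \<open>k\<close> serves.\<close>
  proof (cases "\<L> = {}")
    case False
    then obtain L0 where "L0 \<in> \<L>" by blast
    then have "asdim L leaf_dist = asdim L0 leaf_dist" if "L \<in> \<L>" for L
      using that asdim_generic_leaves unfolding \<L>_def by blast
    then show ?thesis by blast
  qed simp
  then show ?thesis
    using sat res mem by blast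
qed

end
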